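(* For all positive integers $m$ and $p$, $$2\sum_{n=1}^\infty\frac{T_n(\{1\}_{2m-2})\,T_n(\{1\}_{2p-2})}{2n-1}(-1)^n=(-1)^{m-1}\sum_{j=1}^pW(2j+2m-3,2m-1)\,Z(j,p).$$
   Context: $\{1\}_a$ denotes the sequence of $a$ ones. $T_n(\emptyset):=1$, and for $n\ge1$, $a\ge1$: $T_n(\{1\}_{2a})=\sum\frac{2^{2a}}{\prod_{i=1}^a(2n_{2i-1}-1)(2n_{2i})}$, summed over integers $0<n_1\le n_2<n_3\le n_4<\cdots<n_{2a-1}\le n_{2a}<n$ (empty sum $=0$). For positive integers $k_1,\dots,k_r$, $\bar T(k_1,\ldots,k_r):=2^r\sum_{0<n_1<\cdots<n_r}\frac{(-1)^{n_r}}{(2n_1-1)^{k_1}(2n_2-2)^{k_2}\cdots(2n_r-r)^{k_r}}$. $I(k,r)$ is the set of tuples of positive integers $(k_1,\dots,k_r)$ with sum $k$; $W(k,r):=\sum_{(k_1,\dots,k_r)\in I(k,r)}\bar T(k_1,\dots,k_r)$. $\bar\zeta(s):=\sum_{n\ge1}(-1)^{n-1}n^{-s}$ for $s\ge1$, $\bar\zeta(0):=1/2$. For $1\le j\le p$: $Z(p,p):=1$ and for $j<p$, $Z(j,p):=\sum_{k=1}^{p-j}(-2)^k\sum_{j=i_0<i_1<\cdots<i_k=p}\prod_{l=1}^k\bar\zeta(2i_l-2i_{l-1})$. *)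

theory Defs
  imports Complex_Main
begin

definition T_idx :: "nat \<Rightarrow> nat \<Rightarrow> nat list set" where
  "T_idx a n = {ns. length ns = 2 * a \<and>
      (\<forall>i < 2 * a. 0 < ns ! i \<and> ns ! i < n) \<and>
      (\<forall>i < a. ns ! (2 * i) \<le> ns ! (2 * i + 1)) \<and>
      (\<forall>i. i + 1 < a \<longrightarrow> ns ! (2 * i + 1) < ns ! (2 * i + 2))}"

text \<open>T_n({1}_{2a}); for a = 0 the only tuple is the empty one, giving 1.\<close>
definition Tone :: "nat \<Rightarrow> nat \<Rightarrow> real" where
  "Tone a n = (\<Sum>ns \<in> T_idx a n. 2 ^ (2 * a) /
      (\<Prod>i < a. (2 * real (ns ! (2 * i)) - 1) * (2 * real (ns ! (2 * i + 1)))))"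

definition Tbar_idx :: "nat \<Rightarrow> nat \<Rightarrow> nat list set" where
  "Tbar_idx r m = {ns. length ns = r \<and> sorted_wrt (<) ns \<and> (\<forall>x \<in> set ns. 0 < x) \<and> last ns = m}"

text \<open>\bar T(k_1,...,k_r), summed by partial sums over the outermost index n_r.\<close>
definition Tbar :: "nat list \<Rightarrow> real" where
  "Tbar ks = 2 ^ length ks * (\<Sum>m. \<Sum>ns \<in> Tbar_idx (length ks) m.
      (-1) ^ m / (\<Prod>i < length ks. (2 * real (ns ! i) - real (i + 1)) ^ (ks ! i)))"

definition W :: "nat \<Rightarrow> nat \<Rightarrow> real" where
  "W k r = (\<Sum>ks \<in> {ks. length ks = r \<and> (\<forall>x \<in> set ks. 0 < x) \<and> sum_list ks = k}. Tbar ks)"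

definition zetabar :: "nat \<Rightarrow> real" where
  "zetabar s = (if s = 0 then 1 / 2 else (\<Sum>n. (-1) ^ n / real (n + 1) ^ s))"

definition Z :: "nat \<Rightarrow> nat \<Rightarrow> real" where
  "Z j p = (if j = p then 1 else
     (\<Sum>k = 1..p - j. (-2) ^ k *
        (\<Sum>is \<in> {is. length is = k + 1 \<and> sorted_wrt (<) is \<and> is ! 0 = j \<and> is ! k = p}.
           (\<Prod>l = 1..k. zetabar (2 * (is ! l) - 2 * (is ! (l - 1)))))))"

end

theory Submission
  imports Defs "HOL-Analysis.Analysis"
begin

text \<open>
  Put \<open>L(t) = ln ((1 + t) / (1 - t))\<close>. Integration by parts shows that the even moments
  \<open>(2n - 1) \<integral> t\<^sup>2\<^sup>n\<^sup>-\<^sup>2 L\<^sup>2\<^sup>k / (2k)! dt\<close> over \<open>[0, 1]\<close> obey the recursion of the sums \<open>T\<^sub>n({1}\<^sub>2\<^sub>i)\<close>, with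
  initial values \<open>2 \<zeta>(2k)\<close> (alternating zeta). Hence they are a unitriangular combination of the
  \<open>T\<^sub>n({1}\<^sub>2\<^sub>i)\<close>, and the numbers \<open>Z(j, p)\<close> invert that combination. It remains to sum
  \<open>(-1)\<^sup>n T\<^sub>n({1}\<^sub>2\<^sub>m\<^sub>-\<^sub>2)\<close> against the moments. Since \<open>\<Sum> (-1)\<^sup>n\<^sup>-\<^sup>1 T\<^sub>n({1}\<^sub>2\<^sub>a) t\<^sup>2\<^sup>n\<^sup>-\<^sup>2\<close> is, up to sign,
  \<open>(2 arctan t)\<^sup>2\<^sup>a / ((2a)! (1 + t\<^sup>2))\<close>, dominated convergence turns this sum into the integral of
  \<open>L\<^sup>2\<^sup>k (2 arctan t)\<^sup>2\<^sup>m\<^sup>-\<^sup>2 / (1 + t\<^sup>2)\<close>. The substitution \<open>t = (1 - s) / (1 + s)\<close> turns \<open>L\<close> into \<open>- ln s\<close> and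
  \<open>2 arctan t\<close> into \<open>\<pi>/2 - 2 arctan s\<close>, and the new integrand has an explicit antiderivative built from
  the power series whose values at \<open>1\<close> are the sums \<open>W\<close>.
\<close>

section \<open>Abel continuity and alternating series\<close>

text \<open>Abel's theorem by summation by parts. With \<open>d n\<close> the error of the partial
  sum, \<open>f x - s\<close> is \<open>1 - x\<close> times a power series whose coefficients tend
  to 0. It is needed because the series evaluated at 1 may converge only conditionally.\<close>

lemma Abel_limit_continuous_on:
  fixes a :: "nat \<Rightarrow> real"
  assumes "summable a"
  shows "continuous_on {0..1} (\<lambda>x. \<Sum>n. a n * x ^ n)"
proof -
  define s where "s = suminf a"
  define f where "f = (\<lambda>x. \<Sum>n. a n * x ^ n)"
  define d where "d = (\<lambda>n. (\<Sum>k<n. a k) - s)"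
  have d0: "d \<longlonglongrightarrow> 0"
    unfolding d_def s_def using assms by (simp add: LIM_zero summable_LIMSEQ)
  have sa: "summable (\<lambda>n. a n * 1 ^ n)" using assms by simp
  have fs: "f x - s = (1 - x) * (\<Sum>n. d (Suc n) * x ^ n)"
       and ds: "summable (\<lambda>n. d (Suc n) * x ^ n)" "summable (\<lambda>n. norm (d (Suc n) * x ^ n))"
    if x: "0 \<le> x" "x < 1" for x
  proof -
    obtain K where K: "\<And>n. norm (d n) \<le> K"
      using convergent_imp_bounded[OF d0] by (auto simp: bounded_iff)
    have nd: "summable (\<lambda>n. norm (d n * x ^ n))"
    proof (rule summable_comparison_test')
      show "summable (\<lambda>n. K * x ^ n)" using x by (intro summable_mult summable_geometric) auto
      show "norm (norm (d n * x ^ n)) \<le> K * x ^ n" for n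
        using K[of n] x by (simp add: abs_mult mult_right_mono)
    qed
    show nds: "summable (\<lambda>n. norm (d (Suc n) * x ^ n))"
    proof (rule summable_comparison_test')
      show "summable (\<lambda>n. K * x ^ n)" using x by (intro summable_mult summable_geometric) auto
      show "norm (norm (d (Suc n) * x ^ n)) \<le> K * x ^ n" for n
        using K[of "Suc n"] x by (simp add: abs_mult mult_right_mono)
    qed
    have sd: "summable (\<lambda>n. d n * x ^ n)" using nd by (rule summable_norm_cancel)
    show sds: "summable (\<lambda>n. d (Suc n) * x ^ n)" using nds by (rule summable_norm_cancel)
    have "f x = (\<Sum>n. d (Suc n) * x ^ n - d n * x ^ n)"
      unfolding f_def by (intro suminf_cong) (simp add: d_def algebra_simps)
    also have "\<dots> = (\<Sum>n. d (Suc n) * x ^ n) - (\<Sum>n. d n * x ^ n)"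
      by (rule suminf_diff[symmetric, OF sds sd])
    also have "(\<Sum>n. d n * x ^ n) = d 0 + (\<Sum>n. d (Suc n) * x ^ Suc n)"
      using suminf_split_head[OF sd] by simp
    also have "(\<Sum>n. d (Suc n) * x ^ Suc n) = x * (\<Sum>n. d (Suc n) * x ^ n)"
      using suminf_mult[OF sds, of x] by (simp add: algebra_simps)
    finally show "f x - s = (1 - x) * (\<Sum>n. d (Suc n) * x ^ n)"
      by (simp add: d_def algebra_simps)
  qed
  have f1: "f 1 = s" by (simp add: f_def s_def)
  have lim: "(f \<longlongrightarrow> f 1) (at 1 within {0..1})"
  proof (rule tendstoI)
    fix e :: real assume e: "0 < e"
    from LIMSEQ_D[OF d0, of "e/2"] e obtain N where N: "\<And>n. n \<ge> N \<Longrightarrow> \<bar>d n\<bar> < e / 2" by auto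
    define M where "M = (\<Sum>n<N. \<bar>d (Suc n)\<bar>)"
    have key: "\<bar>f x - s\<bar> \<le> (1 - x) * M + e / 2" if x: "0 \<le> x" "x < 1" for x
    proof -
      have "\<bar>\<Sum>n. d (Suc n) * x ^ n\<bar> \<le> (\<Sum>n. \<bar>d (Suc n)\<bar> * x ^ n)"
        using summable_norm[OF ds(2)[OF x]] x by (simp add: abs_mult)
      \<comment> \<open>Beyond \<open>N\<close> every error is below \<open>e / 2\<close>, and the
        sum of that geometric majorant cancels the factor \<open>1 - x\<close>. Only the finite part
        \<open>M\<close> still needs \<open>x\<close> close to 1.\<close>
      also have "\<dots> \<le> (\<Sum>n. (if n < N then \<bar>d (Suc n)\<bar> else 0) + e / 2 * x ^ n)"
      proof (rule suminf_le)
        show "\<bar>d (Suc n)\<bar> * x ^ n \<le> (if n < N then \<bar>d (Suc n)\<bar> else 0) + e / 2 * x ^ n" for n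
        proof (cases "n < N")
          case True
          have "\<bar>d (Suc n)\<bar> * x ^ n \<le> \<bar>d (Suc n)\<bar> * 1"
            using x by (intro mult_left_mono power_le_one) auto
          moreover have "e / 2 * x ^ n \<ge> 0" using e x by simp
          ultimately show ?thesis using True by simp
        next
          case False
          then show ?thesis using N[of "Suc n"] mult_right_mono[of "\<bar>d (Suc n)\<bar>" "e / 2" "x ^ n"] x by simp
        qed
        show "summable (\<lambda>n. \<bar>d (Suc n)\<bar> * x ^ n)" using ds(2)[OF x] x by (simp add: abs_mult)
        show "summable (\<lambda>n. (if n < N then \<bar>d (Suc n)\<bar> else 0) + e / 2 * x ^ n)"
          using x by (intro summable_add summable_mult summable_geometric summable_finite[of "{..<N}"]) auto
      qed
      also have "\<dots> = M + e / 2 * (1 / (1 - x))"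
      proof -
        have "(\<Sum>n. if n < N then \<bar>d (Suc n)\<bar> else 0) = M"
          unfolding M_def by (subst suminf_finite[of "{..<N}"]) auto
        moreover have "(\<Sum>n. e / 2 * x ^ n) = e / 2 * (1 / (1 - x))"
          using x by (simp add: suminf_mult suminf_geometric del: times_divide_eq_left)
        moreover have "summable (\<lambda>n. if n < N then \<bar>d (Suc n)\<bar> else 0)"
          by (rule summable_finite[of "{..<N}"]) auto
        moreover have "summable (\<lambda>n. e / 2 * x ^ n)"
          using x by (intro summable_mult summable_geometric) auto
        ultimately show ?thesis by (subst suminf_add[symmetric]) auto
      qed
      finally have "\<bar>f x - s\<bar> \<le> (1 - x) * (M + e / 2 * (1 / (1 - x)))"
        using x by (simp add: fs abs_mult)
      also have "\<dots> = (1 - x) * M + e / 2" using x by (simp add: field_simps)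
      finally show ?thesis .
    qed
    have "eventually (\<lambda>x. x \<in> {0..1} \<and> x \<noteq> 1) (at 1 within {0..1::real})"
      by (simp add: eventually_at_filter)
    moreover have "eventually (\<lambda>x. (1 - x) * M < e / 2) (at 1 within {0..1::real})"
    proof (rule order_tendstoD)
      show "((\<lambda>x. (1 - x) * M) \<longlongrightarrow> (1 - 1) * M) (at 1 within {0..1})" by (intro tendsto_intros)
    qed (use e in auto)
    ultimately show "eventually (\<lambda>x. dist (f x) (f 1) < e) (at 1 within {0..1})"
    proof eventually_elim
      case (elim x)
      then show ?case using key[of x] by (auto simp: dist_real_def f1)
    qed
  qed
  have "(f \<longlongrightarrow> f x) (at x within {0..1})" if "x \<in> {0..1}" for x
  proof (cases "x = 1")
    case False
    then have "isCont f x"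
      unfolding f_def using that by (intro isCont_powser[OF sa]) auto
    then show ?thesis by (meson continuous_at_imp_continuous_at_within continuous_within)
  qed (use lim in simp)
  then show ?thesis unfolding continuous_on_def f_def by blast
qed

text \<open>Let \<open>u n\<close> be the variation of \<open>b\<close> from \<open>n\<close>
  onwards. Then \<open>b = u - (u - b)\<close> is a difference of two sequences decreasing to 0, and
  Leibniz' criterion applies to each.\<close>

lemma summable_alternating_bounded_variation:
  fixes b :: "nat \<Rightarrow> real"
  assumes b0: "b \<longlonglongrightarrow> 0" and bv: "summable (\<lambda>n. \<bar>b (Suc n) - b n\<bar>)"
  shows "summable (\<lambda>n. (-1) ^ n * b n)"
proof -
  define u where "u = (\<lambda>n. \<Sum>i. \<bar>b (Suc (i + n)) - b (i + n)\<bar>)"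
  have sh: "summable (\<lambda>i. \<bar>b (Suc (i + n)) - b (i + n)\<bar>)" for n
    using summable_ignore_initial_segment[OF bv, of n] by simp
  have us: "u n = \<bar>b (Suc n) - b n\<bar> + u (Suc n)" for n
    using suminf_split_head[OF sh[of n]] by (simp add: u_def)
  have u0: "u \<longlonglongrightarrow> 0"
  proof -
    have "u = (\<lambda>n. (\<Sum>i. \<bar>b (Suc i) - b i\<bar>) - (\<Sum>i<n. \<bar>b (Suc i) - b i\<bar>))"
      unfolding u_def using suminf_minus_initial_segment[OF bv] by auto
    moreover have "\<dots> \<longlonglongrightarrow> (\<Sum>i. \<bar>b (Suc i) - b i\<bar>) - (\<Sum>i. \<bar>b (Suc i) - b i\<bar>)"
      by (intro tendsto_intros summable_LIMSEQ bv)
    ultimately show ?thesis by simp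
  qed
  have "u (Suc n) \<le> u n" for n using us[of n] by linarith
  then have "summable (\<lambda>n. (-1) ^ n * u n)"
    by (intro summable_Leibniz(1) u0 decseq_imp_monoseq decseq_SucI)
  moreover have "summable (\<lambda>n. (-1) ^ n * (u n - b n))"
  proof (intro summable_Leibniz(1) decseq_imp_monoseq decseq_SucI)
    show "(\<lambda>n. u n - b n) \<longlonglongrightarrow> 0" using tendsto_diff[OF u0 b0] by simp
    show "u (Suc n) - b (Suc n) \<le> u n - b n" for n using us[of n] by linarith
  qed
  ultimately have "summable (\<lambda>n. (-1) ^ n * u n - (-1) ^ n * (u n - b n))"
    by (rule summable_diff)
  then show ?thesis by (simp add: algebra_simps)
qed

text \<open>The product rises by \<open>x (Suc n) * c (Suc n)\<close> and falls by
  \<open>e n\<close>. The rises are summable by hypothesis and the net changes by telescoping, hence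
  so are the falls, and the product has bounded variation.\<close>

lemma summable_alternating_partial_sums:
  fixes x c :: "nat \<Rightarrow> real"
  assumes x: "\<And>n. x n \<ge> 0" and c: "\<And>n. c (Suc n) \<le> c n"
    and c0: "\<And>n. c n \<ge> 0" and xc: "summable (\<lambda>n. x n * c n)" and lim: "(\<lambda>n. (\<Sum>i\<le>n. x i) * c n) \<longlonglongrightarrow> 0"
  shows "summable (\<lambda>n. (-1) ^ n * ((\<Sum>i\<le>n. x i) * c n))"
proof (rule summable_alternating_bounded_variation[OF lim])
  define b where "b = (\<lambda>n. (\<Sum>i\<le>n. x i) * c n)"
  define e where "e = (\<lambda>n. (\<Sum>i\<le>n. x i) * (c n - c (Suc n)))"
  have xc': "summable (\<lambda>n. x (Suc n) * c (Suc n))" using xc by (subst summable_Suc_iff)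
  have b: "b (Suc n) - b n = x (Suc n) * c (Suc n) - e n" for n
    by (simp add: b_def e_def algebra_simps)
  have "summable (\<lambda>n. b (Suc n) - b n)"
    using lim unfolding b_def by (rule telescope_summable)
  then have "summable (\<lambda>n. x (Suc n) * c (Suc n) - (b (Suc n) - b n))"
    by (rule summable_diff[OF xc'])
  then have e: "summable e" by (simp add: b)
  have e0: "e n \<ge> 0" for n unfolding e_def using x c by (intro mult_nonneg_nonneg sum_nonneg) auto
  have "summable (\<lambda>n. x (Suc n) * c (Suc n) + e n)" by (intro summable_add xc' e)
  then show "summable (\<lambda>n. \<bar>(\<Sum>i\<le>Suc n. x i) * c (Suc n) - (\<Sum>i\<le>n. x i) * c n\<bar>)"
  proof (rule summable_comparison_test')
    fix n :: nat assume "n \<ge> 0"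
    have "x (Suc n) * c (Suc n) \<ge> 0" using x c0 by simp
    then show "norm \<bar>(\<Sum>i\<le>Suc n. x i) * c (Suc n) - (\<Sum>i\<le>n. x i) * c n\<bar> \<le> x (Suc n) * c (Suc n) + e n"
      using b[of n] e0[of n] unfolding b_def by simp
  qed
qed

section \<open>Chain sums\<close>

text \<open>A strictly increasing tuple of indices \<open>n\<^sub>i\<close> is recorded by the weakly increasing
  \<open>l\<^sub>i = n\<^sub>i - i\<close>, so that \<open>2n\<^sub>i - i = 2l\<^sub>i + i\<close>. The argument \<open>l\<close> is the outermost index, and the
  exponents are listed from the outermost inwards.\<close>

fun chain_sum :: "nat list \<Rightarrow> nat \<Rightarrow> real" where
  "chain_sum [] l = (if l = 0 then 1 else 0)"
| "chain_sum (k # ks) l = 2 * (\<Sum>i\<le>l. chain_sum ks i) / real (2 * l + length ks + 1) ^ k"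

text \<open>The sum of \<^const>\<open>chain_sum\<close> over all compositions of \<open>k + r\<close> into \<open>r\<close> parts; the last two
  equations split off compositions whose outermost part is 1.\<close>

fun hchain :: "nat \<Rightarrow> nat \<Rightarrow> nat \<Rightarrow> real" where
  "hchain 0 0 l = (if l = 0 then 1 else 0)"
| "hchain 0 (Suc k) l = 0"
| "hchain (Suc r) 0 l = 2 * (\<Sum>i\<le>l. hchain r 0 i) / real (2 * l + r + 1)"
| "hchain (Suc r) (Suc k) l =
     (hchain (Suc r) k l + 2 * (\<Sum>i\<le>l. hchain r (Suc k) i)) / real (2 * l + r + 1)"

lemma chain_sum_nonneg: "chain_sum ks l \<ge> 0"
  by (induction ks arbitrary: l) (auto intro!: divide_nonneg_nonneg sum_nonneg)

lemma hchain_nonneg: "hchain r k l \<ge> 0"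
  by (induction r k l rule: hchain.induct) (auto intro!: divide_nonneg_nonneg add_nonneg_nonneg sum_nonneg)

lemma sum_inverse_sqrt_le: "(\<Sum>i\<le>n. 1 / sqrt (real i + 1)) \<le> 2 * sqrt (real n + 1)"
proof (induction n)
  case (Suc n)
  define a where "a = sqrt (real n + 1)"
  define b where "b = sqrt (real n + 2)"
  have b: "b > 0" "a \<ge> 0" "b\<^sup>2 = a\<^sup>2 + 1" by (auto simp: a_def b_def)
  have "2 * a * b \<le> a\<^sup>2 + b\<^sup>2" using sum_squares_bound[of a b] by simp
  then have "2 * a * b + 1 \<le> 2 * b\<^sup>2" using b by simp
  then have "2 * a + 1 / b \<le> 2 * b" using b by (simp add: field_simps power2_eq_square)
  then show ?case using Suc by (simp add: a_def b_def add.commute)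
qed auto

text \<open>At worst a chain sum behaves like a power of a logarithm over \<open>l\<close>; the
  exponent 1/2 absorbs the logarithms and reproduces itself. Summing \<open>1 / sqrt\<close> gives
  at most \<open>2 * sqrt\<close>, and dividing by a denominator of at least \<open>l + 1\<close>
  returns \<open>1 / sqrt\<close>, at the cost of a factor 4 in the constant.\<close>

lemma chain_sum_bound:
  assumes "\<forall>k \<in> set ks. 0 < k"
  obtains C where "C \<ge> 0" "\<And>l. chain_sum ks l \<le> C / sqrt (real l + 1)"
    "\<And>l. (\<Sum>i\<le>l. chain_sum ks i) \<le> 2 * C * sqrt (real l + 1)"
proof -
  have sumb: "(\<Sum>i\<le>l. f i) \<le> 2 * C * sqrt (real l + 1)"
    if "C \<ge> 0" "\<And>l. f l \<le> C / sqrt (real l + 1)" for f :: "nat \<Rightarrow> real" and C l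
  proof -
    have "(\<Sum>i\<le>l. f i) \<le> (\<Sum>i\<le>l. C * (1 / sqrt (real i + 1)))"
      using that by (intro sum_mono) auto
    also have "\<dots> = C * (\<Sum>i\<le>l. 1 / sqrt (real i + 1))" by (simp add: sum_distrib_left)
    also have "\<dots> \<le> C * (2 * sqrt (real l + 1))"
      using that(1) by (intro mult_left_mono sum_inverse_sqrt_le)
    finally show ?thesis by simp
  qed
  have "\<exists>C\<ge>0. \<forall>l. chain_sum ks l \<le> C / sqrt (real l + 1)"
    using assms
  proof (induction ks)
    case Nil
    show ?case by (rule exI[of _ 1]) auto
  next
    case (Cons k ks)
    then obtain C where C: "C \<ge> 0" "\<And>l. chain_sum ks l \<le> C / sqrt (real l + 1)" by auto
    show ?case
    proof (rule exI[of _ "4 * C"], intro conjI allI)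
      fix l
      have "real (2 * l + length ks + 1) ^ 1 \<le> real (2 * l + length ks + 1) ^ k"
        using Cons.prems by (intro power_increasing) auto
      then have d: "real l + 1 \<le> real (2 * l + length ks + 1) ^ k" by simp
      have "chain_sum (k # ks) l \<le> 2 * (2 * C * sqrt (real l + 1)) / (real l + 1)"
        unfolding chain_sum.simps
        using sumb[of C "chain_sum ks" l, OF C] d C(1)
        by (intro frac_le mult_left_mono) auto
      also have "\<dots> = 4 * C / sqrt (real l + 1)"
        by (simp add: real_div_sqrt field_simps flip: power2_eq_square)
      finally show "chain_sum (k # ks) l \<le> 4 * C / sqrt (real l + 1)" .
    qed (use C in auto)
  qed
  then obtain C where "C \<ge> 0" "\<And>l. chain_sum ks l \<le> C / sqrt (real l + 1)" by auto
  then show ?thesis using sumb by (intro that[of C]) auto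
qed

text \<open>The outermost denominator supplies the decreasing factor \<open>c\<close> and the inner
  chain sum the terms \<open>x\<close>. Their product is of order \<open>n powr (- 3/2)\<close>, so
  the bounded variation criterion applies even when all exponents are 1.\<close>

lemma summable_alternating_chain_sum:
  assumes "\<forall>k \<in> set ks. 0 < k"
  shows "summable (\<lambda>l. (-1) ^ l * chain_sum ks l)"
proof (cases ks)
  case Nil
  show ?thesis unfolding Nil by (rule summable_finite[of "{0}"]) auto
next
  case (Cons k ks')
  obtain C where C: "C \<ge> 0" "\<And>l. chain_sum ks' l \<le> C / sqrt (real l + 1)"
    "\<And>l. (\<Sum>i\<le>l. chain_sum ks' i) \<le> 2 * C * sqrt (real l + 1)"
    using chain_sum_bound[of ks'] assms Cons by auto
  define c where "c = (\<lambda>l. 1 / real (2 * l + length ks' + 1) ^ k)"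
  have c0: "c l \<ge> 0" for l by (simp add: c_def)
  have cb: "c l \<le> 1 / (real l + 1)" for l
  proof -
    have "real (2 * l + length ks' + 1) ^ 1 \<le> real (2 * l + length ks' + 1) ^ k"
      using assms Cons by (intro power_increasing) auto
    then show ?thesis unfolding c_def by (intro frac_le) auto
  qed
  have "summable (\<lambda>n. (-1) ^ n * ((\<Sum>i\<le>n. chain_sum ks' i) * c n))"
  proof (rule summable_alternating_partial_sums[OF chain_sum_nonneg _ c0])
    show "c (Suc n) \<le> c n" for n
      unfolding c_def by (intro divide_left_mono power_mono) auto
    have "summable (\<lambda>n. C * (1 / real n powr (3/2)))"
      using summable_real_powr_iff[of "- (3/2)"] by (intro summable_mult) (simp add: powr_minus_divide)
    then have "summable (\<lambda>n. C * (1 / real (Suc n) powr (3/2)))"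
      by (subst summable_Suc_iff)
    then show "summable (\<lambda>n. chain_sum ks' n * c n)"
    proof (rule summable_comparison_test')
      fix n :: nat assume "n \<ge> 0"
      have "chain_sum ks' n * c n \<le> C / sqrt (real n + 1) * (1 / (real n + 1))"
        using C c0 cb by (intro mult_mono) auto
      also have "\<dots> = C * (1 / real (Suc n) powr (3/2))"
        using powr_add[of "real n + 1" "1/2" 1] by (simp add: powr_half_sqrt field_simps add.commute)
      finally show "norm (chain_sum ks' n * c n) \<le> C * (1 / real (Suc n) powr (3/2))"
        using c0 chain_sum_nonneg by simp
    qed
    show "(\<lambda>n. (\<Sum>i\<le>n. chain_sum ks' i) * c n) \<longlonglongrightarrow> 0"
    proof (rule Lim_null_comparison)
      show "eventually (\<lambda>n. norm ((\<Sum>i\<le>n. chain_sum ks' i) * c n) \<le> 2 * C / sqrt (real n + 1)) sequentially"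
      proof (intro always_eventually allI)
        fix n
        have "(\<Sum>i\<le>n. chain_sum ks' i) * c n \<le> 2 * C * sqrt (real n + 1) * (1 / (real n + 1))"
          using C c0 cb by (intro mult_mono) auto
        also have "\<dots> = 2 * C / sqrt (real n + 1)"
          by (simp add: real_div_sqrt field_simps flip: power2_eq_square)
        finally show "norm ((\<Sum>i\<le>n. chain_sum ks' i) * c n) \<le> 2 * C / sqrt (real n + 1)"
          using c0 chain_sum_nonneg by (simp add: sum_nonneg)
      qed
      have "filterlim (\<lambda>n. sqrt (real n + 1)) at_top sequentially"
        using filterlim_compose[OF sqrt_at_top filterlim_compose[OF filterlim_real_sequentially filterlim_Suc]]
        by (simp add: add.commute)
      then show "(\<lambda>n. 2 * C / sqrt (real n + 1)) \<longlonglongrightarrow> 0"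
        by (intro tendsto_divide_0[OF tendsto_const] filterlim_at_top_imp_at_infinity)
    qed
  qed
  then have "summable (\<lambda>n. 2 * ((-1) ^ n * ((\<Sum>i\<le>n. chain_sum ks' i) * c n)))"
    by (rule summable_mult)
  then show ?thesis by (simp add: Cons c_def mult_ac)
qed

section \<open>Compositions and the chain sums added up over them\<close>

definition comps :: "nat \<Rightarrow> nat \<Rightarrow> nat list set" where
  "comps r s = {ks. length ks = r \<and> (\<forall>x \<in> set ks. 0 < x) \<and> sum_list ks = s}"

lemma finite_comps: "finite (comps r s)"
proof (rule finite_subset)
  show "comps r s \<subseteq> {ks. set ks \<subseteq> {..s} \<and> length ks = r}"
    unfolding comps_def using member_le_sum_list by fastforce
  show "finite {ks. set ks \<subseteq> {..s} \<and> length ks = r}" by (rule finite_lists_length_eq) simp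
qed

lemma comps_sum_ge: "ks \<in> comps r s \<Longrightarrow> r \<le> s"
proof -
  have "(\<forall>x \<in> set ks. 0 < x) \<Longrightarrow> length ks \<le> sum_list ks" for ks :: "nat list"
    by (induction ks) auto
  then show "ks \<in> comps r s \<Longrightarrow> r \<le> s" by (auto simp: comps_def)
qed

text \<open>A head equal to 1 is removed, a larger head is lowered by 1. This is the case
  distinction behind the recursion of \<open>hchain\<close>.\<close>

lemma comps_Suc:
  "comps (Suc r) (Suc s) = (#) 1 ` comps r s \<union> (\<lambda>ks. Suc (hd ks) # tl ks) ` comps (Suc r) s"
proof (intro equalityI subsetI)
  fix ks assume "ks \<in> comps (Suc r) (Suc s)"
  then obtain k ks' where ks: "ks = k # ks'" "k > 0" "\<forall>x\<in>set ks'. 0 < x" "length ks' = r"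
      "k + sum_list ks' = Suc s"
    unfolding comps_def by (cases ks) auto
  show "ks \<in> (#) 1 ` comps r s \<union> (\<lambda>ks. Suc (hd ks) # tl ks) ` comps (Suc r) s"
  proof (cases "k = 1")
    case True
    then show ?thesis using ks by (auto simp: comps_def)
  next
    case False
    then have "(k - 1) # ks' \<in> comps (Suc r) s" using ks by (auto simp: comps_def)
    moreover have "ks = Suc (hd ((k - 1) # ks')) # tl ((k - 1) # ks')" using ks by simp
    ultimately show ?thesis by blast
  qed
next
  fix ks assume "ks \<in> (#) 1 ` comps r s \<union> (\<lambda>ks. Suc (hd ks) # tl ks) ` comps (Suc r) s"
  then show "ks \<in> comps (Suc r) (Suc s)"
  proof
    assume "ks \<in> (\<lambda>ks. Suc (hd ks) # tl ks) ` comps (Suc r) s"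
    then obtain ks' where "ks = Suc (hd ks') # tl ks'" "ks' \<in> comps (Suc r) s" by auto
    then show ?thesis by (cases ks') (auto simp: comps_def)
  qed (auto simp: comps_def)
qed

lemma hchain_eq_sum_chain_sum: "hchain r k l = (\<Sum>ks \<in> comps r (k + r). chain_sum ks l)"
proof (induction r k l rule: hchain.induct)
  case (1 l)
  have "comps 0 0 = {[]}" by (auto simp: comps_def)
  then show ?case by simp
next
  case (2 k l)
  have "comps 0 (Suc k) = {}" by (auto simp: comps_def)
  then show ?case by simp
next
  case (3 r l)
  \<comment> \<open>A total of \<open>r\<close> is too small for \<open>Suc r\<close> positive
    parts, so with total \<open>Suc r\<close> the head must be 1.\<close>
  have "comps (Suc r) r = {}" using comps_sum_ge by fastforce
  then have "comps (Suc r) (Suc r) = (#) 1 ` comps r r" by (simp add: comps_Suc)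
  then have "(\<Sum>ks \<in> comps (Suc r) (0 + Suc r). chain_sum ks l) = (\<Sum>ks \<in> comps r r. chain_sum (1 # ks) l)"
    by (simp add: sum.reindex)
  also have "\<dots> = (\<Sum>ks \<in> comps r r. 2 * (\<Sum>i\<le>l. chain_sum ks i) / real (2 * l + r + 1))"
    by (intro sum.cong) (auto simp: comps_def)
  also have "\<dots> = 2 * (\<Sum>i\<le>l. \<Sum>ks\<in>comps r r. chain_sum ks i) / real (2 * l + r + 1)"
    by (subst sum.swap) (simp add: sum_distrib_left sum_divide_distrib)
  finally show ?case using 3 by simp
next
  case (4 r k l)
  have inj: "inj_on (\<lambda>ks. Suc (hd ks) # tl ks) (comps (Suc r) (k + Suc r))"
  proof (rule inj_onI)
    fix x y assume "x \<in> comps (Suc r) (k + Suc r)" "y \<in> comps (Suc r) (k + Suc r)"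
      "Suc (hd x) # tl x = Suc (hd y) # tl y"
    then show "x = y" by (cases x; cases y) (auto simp: comps_def)
  qed
  have hd0: "hd ks > 0" if "ks \<in> comps (Suc r) s" for ks s
    using that by (cases ks) (auto simp: comps_def)
  have disj: "(#) 1 ` comps r (k + Suc r) \<inter> (\<lambda>ks. Suc (hd ks) # tl ks) ` comps (Suc r) (k + Suc r) = {}"
    using hd0 by fastforce
  have "(\<Sum>ks \<in> comps (Suc r) (Suc k + Suc r). chain_sum ks l)
      = (\<Sum>ks \<in> comps r (k + Suc r). chain_sum (1 # ks) l)
      + (\<Sum>ks \<in> comps (Suc r) (k + Suc r). chain_sum (Suc (hd ks) # tl ks) l)"
  proof -
    have "comps (Suc r) (Suc k + Suc r) = (#) 1 ` comps r (k + Suc r)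
        \<union> (\<lambda>ks. Suc (hd ks) # tl ks) ` comps (Suc r) (k + Suc r)"
      using comps_Suc[of r "k + Suc r"] by simp
    then show ?thesis
      using sum.union_disjoint[OF _ _ disj, of "\<lambda>ks. chain_sum ks l"] sum.reindex[OF inj, of "\<lambda>ks. chain_sum ks l"]
      by (simp add: finite_comps sum.reindex o_def)
  qed
  also have "(\<Sum>ks \<in> comps r (k + Suc r). chain_sum (1 # ks) l)
      = (\<Sum>ks \<in> comps r (k + Suc r). 2 * (\<Sum>i\<le>l. chain_sum ks i) / real (2 * l + r + 1))"
    by (intro sum.cong) (auto simp: comps_def)
  also have "\<dots> = 2 * (\<Sum>i\<le>l. \<Sum>ks\<in>comps r (k + Suc r). chain_sum ks i) / real (2 * l + r + 1)"
    by (subst sum.swap) (simp add: sum_distrib_left sum_divide_distrib)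
  also have "(\<Sum>ks \<in> comps (Suc r) (k + Suc r). chain_sum (Suc (hd ks) # tl ks) l)
     = (\<Sum>ks \<in> comps (Suc r) (k + Suc r). chain_sum ks l / real (2 * l + r + 1))"
  proof (intro sum.cong refl)
    fix ks assume "ks \<in> comps (Suc r) (k + Suc r)"
    then show "chain_sum (Suc (hd ks) # tl ks) l = chain_sum ks l / real (2 * l + r + 1)"
      by (cases ks) (auto simp: comps_def)
  qed
  also have "\<dots> = (\<Sum>ks \<in> comps (Suc r) (k + Suc r). chain_sum ks l) / real (2 * l + r + 1)"
    by (simp add: sum_divide_distrib)
  finally show ?case using 4 by (simp add: add_divide_distrib)
qed

lemma summable_alternating_hchain: "summable (\<lambda>l. (-1) ^ l * hchain r k l)"
  unfolding hchain_eq_sum_chain_sum sum_distrib_left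
  by (intro summable_sum summable_alternating_chain_sum) (auto simp: comps_def)

section \<open>From increasing tuples to chain sums: \<open>Tbar\<close> and
  \<open>W\<close>\<close>

definition incr_lists :: "nat \<Rightarrow> nat \<Rightarrow> nat list set" where
  "incr_lists r m = {ns. length ns = r \<and> sorted_wrt (<) ns \<and> (\<forall>x \<in> set ns. 0 < x \<and> x \<le> m)}"

lemma finite_incr_lists: "finite (incr_lists r m)"
  by (rule finite_subset[OF _ finite_lists_length_eq[of "{..m}" r]]) (auto simp: incr_lists_def)

lemma incr_lists_0 [simp]: "incr_lists 0 m = {[]}" "incr_lists (Suc r) 0 = {}"
  by (auto simp: incr_lists_def length_Suc_conv)

lemma Tbar_idx_Suc:
  "Tbar_idx (Suc r) 0 = {}" "Tbar_idx (Suc r) (Suc m) = (\<lambda>ns. ns @ [Suc m]) ` incr_lists r m"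
proof -
  show "Tbar_idx (Suc r) 0 = {}"
    by (auto simp: Tbar_idx_def) (metis last_in_set length_greater_0_conv less_irrefl zero_less_Suc)
  show "Tbar_idx (Suc r) (Suc m) = (\<lambda>ns. ns @ [Suc m]) ` incr_lists r m"
  proof (intro equalityI subsetI)
    fix ns assume ns: "ns \<in> Tbar_idx (Suc r) (Suc m)"
    then have "ns \<noteq> []" by (auto simp: Tbar_idx_def)
    then obtain ns' x where "ns = ns' @ [x]" by (metis rev_exhaust)
    then show "ns \<in> (\<lambda>ns. ns @ [Suc m]) ` incr_lists r m"
      using ns by (auto simp: Tbar_idx_def incr_lists_def sorted_wrt_append less_Suc_eq_le)
  qed (auto simp: Tbar_idx_def incr_lists_def sorted_wrt_append less_Suc_eq_le)
qed

lemma incr_lists_Suc: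
  "incr_lists (Suc r) (Suc m) = incr_lists (Suc r) m \<union> (\<lambda>ns. ns @ [Suc m]) ` incr_lists r m"
proof (intro equalityI subsetI)
  fix ns assume ns: "ns \<in> incr_lists (Suc r) (Suc m)"
  then have "ns \<noteq> []" by (auto simp: incr_lists_def)
  then obtain ns' x where nx: "ns = ns' @ [x]" by (metis rev_exhaust)
  show "ns \<in> incr_lists (Suc r) m \<union> (\<lambda>ns. ns @ [Suc m]) ` incr_lists r m"
  proof (cases "x = Suc m")
    case True
    then have "ns' \<in> incr_lists r m"
      using ns nx by (auto simp: incr_lists_def sorted_wrt_append less_Suc_eq_le)
    then show ?thesis using True nx by blast
  next
    case False
    then have "ns \<in> incr_lists (Suc r) m"
      using ns nx by (fastforce simp: incr_lists_def sorted_wrt_append)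
    then show ?thesis by blast
  qed
qed (auto simp: incr_lists_def sorted_wrt_append le_Suc_eq less_Suc_eq_le)

definition chain_weight :: "nat list \<Rightarrow> nat list \<Rightarrow> real" where
  "chain_weight ks ns =
     2 ^ length ks / (\<Prod>i < length ks. (2 * real (ns ! i) - real (i + 1)) ^ (ks ! i))"

lemma chain_weight_snoc:
  assumes "length ns = length ks"
  shows "chain_weight (ks @ [k]) (ns @ [x]) =
    chain_weight ks ns * (2 / (2 * real x - real (length ks + 1)) ^ k)"
proof -
  have "(\<Prod>i < length ks. (2 * real ((ns @ [x]) ! i) - real (i + 1)) ^ ((ks @ [k]) ! i))
      = (\<Prod>i < length ks. (2 * real (ns ! i) - real (i + 1)) ^ (ks ! i))"
    using assms by (intro prod.cong) (auto simp: nth_append)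
  then show ?thesis using assms by (simp add: chain_weight_def nth_append)
qed

lemma sum_chain_weight_snoc:
  assumes "length ks = r"
  shows "(\<Sum>ns \<in> (\<lambda>ns. ns @ [x]) ` incr_lists r m. chain_weight (ks @ [k]) ns)
    = 2 / (2 * real x - real (r + 1)) ^ k * (\<Sum>ns \<in> incr_lists r m. chain_weight ks ns)"
proof -
  have "(\<Sum>ns \<in> (\<lambda>ns. ns @ [x]) ` incr_lists r m. chain_weight (ks @ [k]) ns)
      = (\<Sum>ns \<in> incr_lists r m. chain_weight (ks @ [k]) (ns @ [x]))"
    by (subst sum.reindex) (auto simp: inj_on_def)
  also have "\<dots> = (\<Sum>ns \<in> incr_lists r m. chain_weight ks ns * (2 / (2 * real x - real (r + 1)) ^ k))"
    using assms by (intro sum.cong) (auto simp: chain_weight_snoc incr_lists_def)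
  also have "\<dots> = (\<Sum>ns \<in> incr_lists r m. chain_weight ks ns) * (2 / (2 * real x - real (r + 1)) ^ k)"
    by (rule sum_distrib_right[symmetric])
  finally show ?thesis by (simp only: mult.commute)
qed

text \<open>The shift by position turns the bound \<open>m\<close> on the outermost index into the
  bound \<open>m - length ks\<close> on its shifted value. When no tuple fits, the truncated
  subtraction makes the right side an empty sum. The list is reversed because
  \<open>chain_sum\<close> reads exponents from the outermost inwards.\<close>

lemma sum_chain_weight:
  "(\<Sum>ns \<in> incr_lists (length ks) m. chain_weight ks ns) = (\<Sum>i < Suc m - length ks. chain_sum (rev ks) i)"
proof (induction ks arbitrary: m rule: rev_induct)
  case Nil
  then show ?case by (simp add: chain_weight_def sum.delta lessThan_Suc_atMost)
next
  case (snoc k ks)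
  let ?r = "length ks"
  show ?case
  proof (induction m)
    case 0
    show ?case by simp
  next
    case (Suc m)
    have disj: "incr_lists (Suc ?r) m \<inter> (\<lambda>ns. ns @ [Suc m]) ` incr_lists ?r m = {}"
      by (auto simp: incr_lists_def)
    have "(\<Sum>ns \<in> incr_lists (length (ks @ [k])) (Suc m). chain_weight (ks @ [k]) ns)
       = (\<Sum>i < Suc m - length (ks @ [k]). chain_sum (rev (ks @ [k])) i)
       + 2 / (2 * real (Suc m) - real (?r + 1)) ^ k * (\<Sum>i < Suc m - ?r. chain_sum (rev ks) i)"
      using Suc sum_chain_weight_snoc[OF refl, where ks = ks and k = k and x = "Suc m" and m = m] disj snoc[of m]
      by (simp add: incr_lists_Suc sum.union_disjoint finite_incr_lists)
    also have "\<dots> = (\<Sum>i < Suc (Suc m) - length (ks @ [k]). chain_sum (rev (ks @ [k])) i)"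
    proof (cases "?r \<le> m")
      case True
      then obtain l where l: "m = l + ?r" by (metis add.commute le_Suc_ex)
      \<comment> \<open>The new outermost index \<open>Suc m\<close> has shifted value
        \<open>l\<close>, and its denominator is the one in \<open>chain_sum\<close>.\<close>
      have "2 * real (Suc m) - real (?r + 1) = real (2 * l + ?r + 1)" by (simp add: l)
      then show ?thesis by (simp add: l lessThan_Suc_atMost[symmetric])
    qed auto
    finally show ?case .
  qed
qed

text \<open>The outermost index equals \<open>l + length ks\<close>, which accounts for the sign in
  front. Smaller values of it admit no tuple, so the series may start there.\<close>

lemma Tbar_eq:
  assumes "ks \<noteq> []" and pos: "\<forall>k \<in> set ks. 0 < k"
  shows "Tbar ks = (-1) ^ length ks * (\<Sum>l. (-1) ^ l * chain_sum (rev ks) l)"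
proof -
  obtain js k where ks: "ks = js @ [k]" using assms(1) by (metis rev_exhaust)
  let ?r = "length js"
  define f where "f = (\<lambda>m. \<Sum>ns \<in> Tbar_idx (length ks) m.
      (-1) ^ m / (\<Prod>i < length ks. (2 * real (ns ! i) - real (i + 1)) ^ (ks ! i)) :: real)"
  have f: "2 ^ length ks * f m = (-1) ^ m * (\<Sum>ns \<in> Tbar_idx (length ks) m. chain_weight ks ns)" for m
    by (simp add: f_def chain_weight_def sum_distrib_left mult_ac)
  have f_Suc: "2 ^ length ks * f (Suc m) = (-1) ^ Suc m *
      (2 / (2 * real (Suc m) - real (?r + 1)) ^ k * (\<Sum>i < Suc m - ?r. chain_sum (rev js) i))" for m
    using sum_chain_weight_snoc[OF refl, where ks = js and k = k and x = "Suc m" and m = m] sum_chain_weight[of js m]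
    unfolding f by (simp add: ks Tbar_idx_Suc)
  have f0: "2 ^ length ks * f m = 0" if "m < length ks" for m
  proof (cases m)
    case 0
    then show ?thesis unfolding f by (simp add: ks Tbar_idx_Suc)
  next
    case (Suc m')
    then show ?thesis using that f_Suc[of m'] by (simp add: ks)
  qed
  have fl: "2 ^ length ks * f (l + length ks) = (-1) ^ length ks * ((-1) ^ l * chain_sum (rev ks) l)" for l
  proof -
    have "2 * real (Suc (l + ?r)) - real (?r + 1) = real (2 * l + ?r + 1)" by simp
    moreover have "l + length ks = Suc (l + ?r)" by (simp add: ks)
    ultimately show ?thesis
      using f_Suc[of "l + ?r"] by (simp add: ks lessThan_Suc_atMost Suc_diff_le power_add)
  qed
  have "summable (\<lambda>l. (-1) ^ length ks * ((-1) ^ l * chain_sum (rev ks) l))"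
    using pos by (intro summable_mult summable_alternating_chain_sum) auto
  then have "(\<lambda>l. 2 ^ length ks * f (l + length ks)) sums (\<Sum>l. (-1) ^ length ks * ((-1) ^ l * chain_sum (rev ks) l))"
    unfolding fl by (rule summable_sums)
  then have "(\<lambda>m. 2 ^ length ks * f m) sums (\<Sum>l. (-1) ^ length ks * ((-1) ^ l * chain_sum (rev ks) l))"
    using sums_zero_iff_shift[of "length ks" "\<lambda>m. 2 ^ length ks * f m", OF f0] by simp
  then have "f sums ((\<Sum>l. (-1) ^ length ks * ((-1) ^ l * chain_sum (rev ks) l)) / 2 ^ length ks)"
    using sums_divide[of "\<lambda>m. 2 ^ length ks * f m" _ "2 ^ length ks"] by simp
  then have "2 ^ length ks * suminf f = (\<Sum>l. (-1) ^ length ks * ((-1) ^ l * chain_sum (rev ks) l))"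
    by (simp add: sums_iff)
  also have "\<dots> = (-1) ^ length ks * (\<Sum>l. (-1) ^ l * chain_sum (rev ks) l)"
    using pos by (intro suminf_mult summable_alternating_chain_sum) auto
  finally show ?thesis by (simp add: Tbar_def f_def)
qed

lemma W_eq_hchain:
  assumes "r \<ge> 1"
  shows "W (k + r) r = (-1) ^ r * (\<Sum>l. (-1) ^ l * hchain r k l)"
proof -
  have "W (k + r) r = (\<Sum>ks \<in> comps r (k + r). (-1) ^ r * (\<Sum>l. (-1) ^ l * chain_sum (rev ks) l))"
    unfolding W_def comps_def[symmetric] using assms
  proof (intro sum.cong refl)
    fix ks assume "ks \<in> comps r (k + r)"
    then show "Tbar ks = (-1) ^ r * (\<Sum>l. (-1) ^ l * chain_sum (rev ks) l)"
      using assms Tbar_eq[of ks] by (cases ks) (auto simp: comps_def)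
  qed
  \<comment> \<open>Reversal permutes the compositions, so the change of reading direction
    disappears in the sum.\<close>
  also have "\<dots> = (\<Sum>ks \<in> comps r (k + r). (-1) ^ r * (\<Sum>l. (-1) ^ l * chain_sum ks l))"
    by (rule sum.reindex_bij_witness[of _ rev rev]) (auto simp: comps_def sum_list_rev)
  also have "\<dots> = (-1) ^ r * (\<Sum>ks \<in> comps r (k + r). \<Sum>l. (-1) ^ l * chain_sum ks l)"
    by (simp add: sum_distrib_left)
  also have "(\<Sum>ks \<in> comps r (k + r). \<Sum>l. (-1) ^ l * chain_sum ks l)
      = (\<Sum>l. \<Sum>ks \<in> comps r (k + r). (-1) ^ l * chain_sum ks l)"
    by (intro suminf_sum[symmetric] summable_alternating_chain_sum) (auto simp: comps_def)
  finally show ?thesis by (simp add: hchain_eq_sum_chain_sum sum_distrib_left)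
qed

section \<open>Recursions for the T sums\<close>

lemma T_idx_length: "ns \<in> T_idx a n \<Longrightarrow> length ns = 2 * a"
  by (simp add: T_idx_def)

lemma T_idx_0: "T_idx 0 n = {[]}"
  by (auto simp: T_idx_def)

lemma finite_T_idx: "finite (T_idx a n)"
  by (rule finite_subset[OF _ finite_lists_length_eq[of "{..<n}" "2 * a"]])
    (auto simp: T_idx_def in_set_conv_nth)

text \<open>The definition compares neighbours only. Every even position (counted from 0) is
  preceded by a strict inequality, so its entry exceeds all earlier ones, as is needed for cutting a
  tuple there.\<close>

lemma T_idx_mono:
  assumes "ns \<in> T_idx a n" "i < j" "j < 2 * a" "even j"
  shows "ns ! i < ns ! j"
proof -
  have *: "ns ! (2 * k) \<le> ns ! (2 * k + 1)" if "k < a" for k using assms(1) that by (auto simp: T_idx_def)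
  have **: "ns ! (2 * k + 1) < ns ! (2 * k + 2)" if "k + 1 < a" for k using assms(1) that by (auto simp: T_idx_def)
  have "\<forall>i < 2 * k. ns ! i < ns ! (2 * k)" if "k < a" for k
    using that
  proof (induction k)
    case (Suc k)
    have st: "ns ! (2 * k) \<le> ns ! (2 * k + 1)" "ns ! (2 * k + 1) < ns ! (2 * k + 2)"
      using *[of k] **[of k] Suc.prems by auto
    show ?case
    proof (intro allI impI)
      fix i assume i: "i < 2 * Suc k"
      then consider "i < 2 * k" | "i = 2 * k" | "i = 2 * k + 1" by fastforce
      then show "ns ! i < ns ! (2 * Suc k)" using Suc st by cases (auto intro: less_trans)
    qed
  qed simp
  then show ?thesis using assms by (auto elim!: evenE)
qed

text \<open>The last pair is \<open>p \<le> q < n\<close>, and what precedes it is a shorter tuple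
  with strict bound \<open>p\<close>.\<close>

lemma T_idx_Suc:
  "T_idx (Suc a) n = (\<Union>q \<in> {..<n}. \<Union>p \<in> {1..q}. (\<lambda>ns. ns @ [p, q]) ` T_idx a p)"
proof (intro equalityI subsetI)
  fix ns assume ns: "ns \<in> T_idx (Suc a) n"
  then have len: "length ns = 2 * a + 2" by (auto simp: T_idx_def)
  define ms where "ms = take (2 * a) ns"
  define p where "p = ns ! (2 * a)"
  define q where "q = ns ! (2 * a + 1)"
  have nseq: "ns = ms @ [p, q]"
    by (rule nth_equalityI) (auto simp: ms_def p_def q_def len nth_append less_Suc_eq nth_Cons' )
  have pq: "0 < p" "p \<le> q" "q < n" using ns by (auto simp: T_idx_def p_def q_def)
  have "ms \<in> T_idx a p"
    using ns T_idx_mono[OF ns, of _ "2 * a"] unfolding T_idx_def ms_def p_def by (auto simp: len)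
  then show "ns \<in> (\<Union>q \<in> {..<n}. \<Union>p \<in> {1..q}. (\<lambda>ns. ns @ [p, q]) ` T_idx a p)"
    using pq nseq by (intro UN_I[of q] UN_I[of p]) auto
next
  fix ns assume "ns \<in> (\<Union>q \<in> {..<n}. \<Union>p \<in> {1..q}. (\<lambda>ns. ns @ [p, q]) ` T_idx a p)"
  then obtain p q ms where pq: "q < n" "1 \<le> p" "p \<le> q" and ns: "ns = ms @ [p, q]" and ms: "ms \<in> T_idx a p"
    by auto
  have len: "length ms = 2 * a" using ms by (auto simp: T_idx_def)
  have msb: "0 < ms ! i" "ms ! i < p" if "i < 2 * a" for i
    using ms that by (auto simp: T_idx_def)
  show "ns \<in> T_idx (Suc a) n"
    unfolding T_idx_def
  proof (intro CollectI conjI allI impI)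
    fix i assume i: "i < 2 * Suc a"
    then have "i < 2 * a \<or> i = 2 * a \<or> i = 2 * a + 1" by fastforce
    then show "0 < ns ! i"
      using msb[of i] pq len by (auto simp: ns nth_append)
    show "ns ! i < n"
      using \<open>i < 2 * a \<or> i = 2 * a \<or> i = 2 * a + 1\<close> msb[of i] pq len by (auto simp: ns nth_append)
  next
    fix i assume "i < Suc a"
    then consider "i < a" | "i = a" by linarith
    then show "ns ! (2 * i) \<le> ns ! (2 * i + 1)"
      using ms pq len by cases (auto simp: ns nth_append T_idx_def)
  next
    fix i assume "i + 1 < Suc a"
    then consider "i + 1 < a" | "i + 1 = a" by linarith
    then show "ns ! (2 * i + 1) < ns ! (2 * i + 2)"
      using ms pq len by cases (auto simp: ns nth_append T_idx_def)
  qed (simp add: ns len)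
qed

lemma Tone_0 [simp]: "Tone 0 n = 1"
  by (simp add: Tone_def T_idx_0)

lemma Tone_Suc:
  "Tone (Suc a) n = (\<Sum>q<n. \<Sum>p = 1..q. 4 / ((2 * real p - 1) * (2 * real q)) * Tone a p)"
proof -
  define wt where "wt = (\<lambda>a (ns::nat list). 2 ^ (2 * a) /
      (\<Prod>i < a. (2 * real (ns ! (2 * i)) - 1) * (2 * real (ns ! (2 * i + 1)))) :: real)"
  have wt: "wt (Suc a) (ns @ [p, q]) = 4 / ((2 * real p - 1) * (2 * real q)) * wt a ns"
    if "length ns = 2 * a" for ns p q
  proof -
    have "(\<Prod>i < a. (2 * real ((ns @ [p, q]) ! (2 * i)) - 1) * (2 * real ((ns @ [p, q]) ! (2 * i + 1))))
      = (\<Prod>i < a. (2 * real (ns ! (2 * i)) - 1) * (2 * real (ns ! (2 * i + 1))))"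
      using that by (intro prod.cong) (auto simp: nth_append)
    then show ?thesis using that by (simp add: wt_def nth_append)
  qed
  have "Tone (Suc a) n = sum (wt (Suc a)) (T_idx (Suc a) n)" by (simp add: Tone_def wt_def)
  also have "\<dots> = (\<Sum>q<n. sum (wt (Suc a)) (\<Union>p \<in> {1..q}. (\<lambda>ns. ns @ [p, q]) ` T_idx a p))"
    unfolding T_idx_Suc by (rule sum.UNION_disjoint) (auto simp: finite_T_idx)
  also have "\<dots> = (\<Sum>q<n. \<Sum>p = 1..q. sum (wt (Suc a)) ((\<lambda>ns. ns @ [p, q]) ` T_idx a p))"
    by (intro sum.cong refl sum.UNION_disjoint) (auto simp: finite_T_idx)
  also have "\<dots> = (\<Sum>q<n. \<Sum>p = 1..q. \<Sum>ns \<in> T_idx a p. wt (Suc a) (ns @ [p, q]))"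
    by (simp add: sum.reindex inj_on_def)
  also have "\<dots> = (\<Sum>q<n. \<Sum>p = 1..q. 4 / ((2 * real p - 1) * (2 * real q)) * Tone a p)"
    unfolding Tone_def sum_distrib_left
    by (intro sum.cong refl) (simp only: wt[OF T_idx_length], simp only: wt_def)
  finally show ?thesis .
qed

text \<open>This is \<open>T\<^sub>n({1}\<^sub>2\<^sub>a\<^sub>+\<^sub>1)\<close>, the outermost index running up to \<open>n\<close>.\<close>

definition Todd :: "nat \<Rightarrow> nat \<Rightarrow> real" where
  "Todd a n = (\<Sum>p = 1..n. 2 / (2 * real p - 1) * Tone a p)"

lemma Todd_rec: "Todd a 0 = 0" "Todd a (Suc n) = Todd a n + 2 / (2 * real n + 1) * Tone a (Suc n)"
  by (simp_all add: Todd_def)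

lemma Tone_Suc_eq_Todd: "Tone (Suc a) n = (\<Sum>q<n. 2 / (2 * real q) * Todd a q)"
  unfolding Tone_Suc Todd_def sum_distrib_left by (intro sum.cong refl) (simp add: field_simps)

lemma Tone_rec: "Tone (Suc a) (Suc n) = Tone (Suc a) n + 2 / (2 * real n) * Todd a n"
  by (simp add: Tone_Suc_eq_Todd)

text \<open>Writing the i-th pair as \<open>l + i\<close>, \<open>l' + i\<close> turns both kinds of
  inequality into weak ones, and the denominators into \<open>2 l + 2 i - 1\<close> and
  \<open>2 l' + 2 i\<close>. These are the successive denominators of \<open>hchain\<close> with
  \<open>k = 0\<close>, where all exponents are 1.\<close>

lemma Tone_eq_hchain: "Tone a (Suc n) = (\<Sum>l < Suc n - a. hchain (2 * a) 0 l)"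
proof (induction a arbitrary: n)
  case 0
  show ?case by (simp add: lessThan_Suc_atMost)
next
  case (Suc a)
  \<comment> \<open>A pair adds two levels to \<open>hchain\<close>; \<open>Todd\<close> is the
    intermediate level.\<close>
  have odd: "Todd a n = (\<Sum>l < n - a. hchain (2 * a + 1) 0 l)" for n
  proof (induction n)
    case (Suc n)
    show ?case
    proof (cases "a \<le> n")
      case True
      then obtain l where l: "n = l + a" by (metis add.commute le_Suc_ex)
      have "2 * real n + 1 = real (2 * l + 2 * a + 1)" by (simp add: l)
      then show ?thesis using Suc \<open>\<And>n. Tone a (Suc n) = _\<close>[of n]
        by (simp add: Todd_rec l Suc_diff_le lessThan_Suc_atMost[symmetric])
    next
      case False
      then show ?thesis using Suc \<open>\<And>n. Tone a (Suc n) = _\<close>[of n] by (simp add: Todd_rec)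
    qed
  qed (simp add: Todd_rec)
  show ?case
  proof (induction n)
    case 0
    show ?case by (simp add: Tone_Suc)
  next
    case (Suc n)
    show ?case
    proof (cases "a \<le> n")
      case True
      then obtain l where l: "n = l + a" by (metis add.commute le_Suc_ex)
      have "2 * real (Suc n) = real (2 * l + Suc (2 * a) + 1)" by (simp add: l)
      then show ?thesis using Suc odd[of "Suc n"]
        by (simp add: Tone_rec l Suc_diff_le lessThan_Suc_atMost[symmetric])
    next
      case False
      then show ?thesis using Suc odd[of "Suc n"] by (simp add: Tone_rec)
    qed
  qed
qed

section \<open>Inversion of the triangular system defining Z\<close>

definition zpaths :: "nat \<Rightarrow> nat \<Rightarrow> nat \<Rightarrow> nat list set" where
  "zpaths k j p = {is. length is = k + 1 \<and> sorted_wrt (<) is \<and> is ! 0 = j \<and> is ! k = p}"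

definition zpath_sum :: "nat \<Rightarrow> nat \<Rightarrow> nat \<Rightarrow> real" where
  "zpath_sum k j p = (\<Sum>is \<in> zpaths k j p. \<Prod>l = 1..k. zetabar (2 * (is ! l) - 2 * (is ! (l - 1))))"

lemma zpaths_bounds:
  assumes "is \<in> zpaths k j p"
  shows "set is \<subseteq> {..p}" "j + k \<le> p"
proof -
  have len: "length is = k + 1" and srt: "sorted_wrt (<) is" and ends: "is ! 0 = j" "is ! k = p"
    using assms by (auto simp: zpaths_def)
  have "is ! i \<le> p" if "i \<le> k" for i
    using sorted_wrt_nth_less[OF srt, of i k] that ends len by (cases "i = k") auto
  then show "set is \<subseteq> {..p}" by (auto simp: in_set_conv_nth len)
  have "j + i \<le> is ! i" if "i \<le> k" for i
    using that
  proof (induction i)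
    case (Suc i)
    then show ?case using sorted_wrt_nth_less[OF srt, of i "Suc i"] len by simp
  qed (use ends in simp)
  then show "j + k \<le> p" using ends by blast
qed

lemma finite_zpaths: "finite (zpaths k j p)"
  by (rule finite_subset[OF _ finite_lists_length_eq[of "{..p}" "k + 1"]])
    (use zpaths_bounds(1) in \<open>auto simp: zpaths_def\<close>)

lemma zpaths_0: "zpaths 0 j p = (if j = p then {[j]} else {})"
  by (auto simp: zpaths_def length_Suc_conv)

lemma zpaths_Suc: "zpaths (Suc k) j p = (\<Union>i \<in> {j<..p}. (#) j ` zpaths k i p)"
proof (intro equalityI subsetI)
  fix xs assume a: "xs \<in> zpaths (Suc k) j p"
  then obtain ys where ys: "xs = j # ys" by (cases "xs") (auto simp: zpaths_def)
  then have "ys \<in> zpaths k (ys ! 0) p" and "j < ys ! 0"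
    using a by (cases ys; auto simp: zpaths_def)+
  moreover from this have "ys ! 0 \<le> p" using zpaths_bounds(2)[of ys k "ys ! 0" p] by simp
  ultimately show "xs \<in> (\<Union>i \<in> {j<..p}. (#) j ` zpaths k i p)" using ys by auto
next
  fix xs assume "xs \<in> (\<Union>i \<in> {j<..p}. (#) j ` zpaths k i p)"
  then obtain i ys where *: "j < i" "xs = j # ys" "ys \<in> zpaths k i p" by auto
  then obtain js where js: "ys = i # js" by (cases ys) (auto simp: zpaths_def)
  show "xs \<in> zpaths (Suc k) j p"
    using * js by (auto simp: zpaths_def)
qed

lemma zpath_sum_0: "zpath_sum 0 j p = (if j = p then 1 else 0)"
  by (simp add: zpath_sum_def zpaths_0)

lemma zpath_sum_Suc:
  "zpath_sum (Suc k) j p = (\<Sum>i \<in> {j<..p}. zetabar (2 * (i - j)) * zpath_sum k i p)"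
proof -
  define f where "f = (\<lambda>k (is::nat list). \<Prod>l = 1..k. zetabar (2 * (is ! l) - 2 * (is ! (l - 1))))"
  have f: "f (Suc k) (j # is) = zetabar (2 * (i - j)) * f k is" if "is \<in> zpaths k i p" for "is" i
  proof -
    have "f (Suc k) (j # is) = (\<Prod>l \<in> insert 1 {2..Suc k}. zetabar (2 * ((j # is) ! l) - 2 * ((j # is) ! (l - 1))))"
      unfolding f_def by (rule prod.cong) auto
    also have "\<dots> = zetabar (2 * (is ! 0) - 2 * j) *
        (\<Prod>l = 2..Suc k. zetabar (2 * ((j # is) ! l) - 2 * ((j # is) ! (l - 1))))"
      by (subst prod.insert) auto
    also have "(\<Prod>l = 2..Suc k. zetabar (2 * ((j # is) ! l) - 2 * ((j # is) ! (l - 1)))) = f k is"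
      unfolding f_def
      by (rule prod.reindex_bij_witness[of _ Suc "\<lambda>l. l - 1"]) (auto simp: nth_Cons')
    finally show ?thesis using that by (simp add: zpaths_def diff_mult_distrib2)
  qed
  have "zpath_sum (Suc k) j p = (\<Sum>i \<in> {j<..p}. sum (f (Suc k)) ((#) j ` zpaths k i p))"
    unfolding zpath_sum_def zpaths_Suc f_def
    by (rule sum.UNION_disjoint) (auto simp: finite_zpaths, auto simp: zpaths_def)
  also have "\<dots> = (\<Sum>i \<in> {j<..p}. \<Sum>is \<in> zpaths k i p. f (Suc k) (j # is))"
    by (simp add: sum.reindex)
  also have "\<dots> = (\<Sum>i \<in> {j<..p}. zetabar (2 * (i - j)) * zpath_sum k i p)"
    using f unfolding zpath_sum_def sum_distrib_left f_def by (intro sum.cong refl) blast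
  finally show ?thesis .
qed

text \<open>Paths with more than \<open>p - j\<close> steps do not exist, so one cutoff can serve
  several \<open>j\<close>. The term \<open>k = 0\<close> supplies the diagonal value 1.\<close>

lemma Z_eq_zpath_sum:
  assumes "j \<le> p" "p - j < K"
  shows "Z j p = (\<Sum>k<K. (-2) ^ k * zpath_sum k j p)"
proof -
  have z: "zpath_sum k j p = 0" if "p - j < k" for k
  proof -
    have "zpaths k j p = {}" using zpaths_bounds(2)[of _ k j p] that by fastforce
    then show ?thesis by (simp add: zpath_sum_def)
  qed
  have "(\<Sum>k<K. (-2) ^ k * zpath_sum k j p) = (\<Sum>k\<in>{0..p - j}. (-2) ^ k * zpath_sum k j p)"
    by (rule sum.mono_neutral_right) (use assms z in auto)
  also have "\<dots> = zpath_sum 0 j p + (\<Sum>k = 1..p - j. (-2) ^ k * zpath_sum k j p)"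
    by (simp add: sum.atLeast_Suc_atMost)
  also have "\<dots> = Z j p"
    by (cases "j = p") (auto simp: Z_def zpath_sum_0, auto simp: zpath_sum_def zpaths_def)
  finally show ?thesis by simp
qed

text \<open>Paths are split after their first step, from \<open>j\<close> to \<open>i\<close>; one
  factor \<open>-2\<close> goes with that step.\<close>

lemma Z_rec:
  assumes "j < p"
  shows "Z j p = - (\<Sum>i \<in> {j<..p}. 2 * zetabar (2 * (i - j)) * Z i p)"
proof -
  have "Z j p = (\<Sum>k<Suc (p - j). (-2) ^ k * zpath_sum k j p)"
    using assms by (intro Z_eq_zpath_sum) auto
  also have "\<dots> = (\<Sum>k<p - j. (-2) ^ Suc k * zpath_sum (Suc k) j p)"
    using assms by (subst sum.lessThan_Suc_shift) (simp add: zpath_sum_0)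
  also have "\<dots> = (\<Sum>k<p - j. \<Sum>i \<in> {j<..p}. - 2 * zetabar (2 * (i - j)) * ((-2) ^ k * zpath_sum k i p))"
    by (simp add: zpath_sum_Suc sum_distrib_left mult_ac)
  also have "\<dots> = (\<Sum>i \<in> {j<..p}. - 2 * zetabar (2 * (i - j)) * (\<Sum>k<p - j. (-2) ^ k * zpath_sum k i p))"
    by (subst sum.swap) (simp add: sum_distrib_left)
  also have "\<dots> = (\<Sum>i \<in> {j<..p}. - 2 * zetabar (2 * (i - j)) * Z i p)"
    \<comment> \<open>For \<open>i > j\<close> the cutoff \<open>p - j\<close> still exceeds
      \<open>p - i\<close>.\<close>
    using assms by (intro sum.cong refl) (subst Z_eq_zpath_sum[where K = "p - j"], auto)
  finally show ?thesis by (simp add: sum_negf)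
qed

text \<open>Since \<open>zetabar 0\<close> is 1/2, the diagonal coefficient is 1, and moving it to
  the other side of \<open>Z_rec\<close> gives the equation of an inverse unitriangular
  matrix.\<close>

lemma Z_inverse:
  assumes "j \<le> p"
  shows "(\<Sum>i = j..p. 2 * zetabar (2 * (i - j)) * Z i p) = (if j = p then 1 else 0)"
proof (cases "j = p")
  case True
  then show ?thesis by (simp add: zetabar_def Z_def)
next
  case False
  have "{j..p} = insert j {j<..p}" using assms by auto
  then show ?thesis using Z_rec[of j p] False assms by (simp add: zetabar_def)
qed

text \<open>To be applied with \<open>t\<close> the T sums at a fixed \<open>n\<close>; the inner
  sums are then normalised even moments.\<close>

lemma Z_inversion:
  fixes t :: "nat \<Rightarrow> real"
  assumes "1 \<le> p"
  shows "(\<Sum>j = 1..p. (\<Sum>i = 1..j. 2 * zetabar (2 * (j - i)) * t i) * Z j p) = t p"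
proof -
  have "(\<Sum>j = 1..p. (\<Sum>i = 1..j. 2 * zetabar (2 * (j - i)) * t i) * Z j p)
      = (\<Sum>j = 1..p. \<Sum>i | i \<in> {1..p} \<and> i \<le> j. 2 * zetabar (2 * (j - i)) * t i * Z j p)"
    unfolding sum_distrib_right by (intro sum.cong refl) auto
  also have "\<dots> = (\<Sum>i = 1..p. \<Sum>j | j \<in> {1..p} \<and> i \<le> j. 2 * zetabar (2 * (j - i)) * t i * Z j p)"
    by (rule sum.swap_restrict) auto
  also have "\<dots> = (\<Sum>i = 1..p. t i * (\<Sum>j = i..p. 2 * zetabar (2 * (j - i)) * Z j p))"
    unfolding sum_distrib_left by (intro sum.cong refl) auto
  also have "\<dots> = (\<Sum>i = 1..p. t i * (if i = p then 1 else 0))"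
    by (intro sum.cong refl) (simp only: atLeastAtMost_iff Z_inverse)
  also have "\<dots> = t p" using assms by (simp add: if_distrib sum.delta cong: if_cong)
  finally show ?thesis .
qed

section \<open>Generating functions of the chain sums\<close>

definition hpow :: "nat \<Rightarrow> nat \<Rightarrow> real \<Rightarrow> real" where
  "hpow r k z = (\<Sum>l. (-1) ^ l * hchain r k l * z ^ l)"

text \<open>The terms carry the power \<open>2 * l + r\<close> of \<open>t\<close>. For positive
  \<open>r\<close> this is the outermost denominator of \<open>hchain r k l\<close>, so
  differentiation removes it.\<close>

definition hgen :: "nat \<Rightarrow> nat \<Rightarrow> real \<Rightarrow> real" where
  "hgen r k t = t ^ r * hpow r k (t\<^sup>2)"

lemma continuous_on_hpow: "continuous_on {0..1} (hpow r k)"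
  unfolding hpow_def by (rule Abel_limit_continuous_on[OF summable_alternating_hchain])

lemma continuous_on_hgen: "continuous_on {0..1} (hgen r k)"
  unfolding hgen_def
  by (intro continuous_intros continuous_on_compose2[OF continuous_on_hpow])
    (auto simp: power_le_one)

lemma hgen_0: "hgen 0 0 t = 1" "hgen 0 (Suc k) t = 0"
proof -
  have "(\<Sum>l. (-1) ^ l * hchain 0 0 l * (t\<^sup>2) ^ l) = (\<Sum>l\<in>{0}. (-1) ^ l * hchain 0 0 l * (t\<^sup>2) ^ l)"
    by (rule suminf_finite) auto
  then show "hgen 0 0 t = 1" by (simp add: hgen_def hpow_def)
  show "hgen 0 (Suc k) t = 0" by (simp add: hgen_def hpow_def)
qed

lemma summable_hpow:
  assumes "\<bar>z\<bar> < 1"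
  shows "summable (\<lambda>l. (-1) ^ l * hchain r k l * z ^ l)"
    "summable (\<lambda>l. norm ((-1) ^ l * hchain r k l * z ^ l))"
proof -
  have "summable (\<lambda>l. (-1) ^ l * hchain r k l * 1 ^ l)"
    using summable_alternating_hchain by simp
  from powser_insidea[OF this, of z] show "summable (\<lambda>l. norm ((-1) ^ l * hchain r k l * z ^ l))"
    using assms by simp
  then show "summable (\<lambda>l. (-1) ^ l * hchain r k l * z ^ l)" by (rule summable_norm_cancel)
qed

text \<open>Cauchy product with the geometric series of \<open>- z\<close>; the signs combine to a
  common \<open>(-1) ^ l\<close>.\<close>

lemma hpow_partial_sums:
  assumes "\<bar>z\<bar> < 1"
  shows "(\<lambda>l. (-1) ^ l * (\<Sum>i\<le>l. hchain r k i) * z ^ l) sums (hpow r k z / (1 + z))"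
proof -
  let ?a = "\<lambda>l. (-1) ^ l * hchain r k l * z ^ l" and ?b = "\<lambda>l. (- z) ^ l"
  have b: "summable (\<lambda>l. norm (?b l))"
    using assms by (simp add: power_abs summable_geometric)
  have eq: "(\<lambda>l. \<Sum>i\<le>l. ?a i * ?b (l - i)) = (\<lambda>l. (-1) ^ l * (\<Sum>i\<le>l. hchain r k i) * z ^ l)"
  proof
    fix l
    have "?a i * ?b (l - i) = (-1) ^ l * z ^ l * hchain r k i" if "i \<le> l" for i
    proof -
      have "?a i * ?b (l - i) = ((-1) ^ i * (-1) ^ (l - i)) * (z ^ i * z ^ (l - i)) * hchain r k i"
        by (simp add: power_minus[of z] mult_ac)
      then show ?thesis using that by (simp flip: power_add)
    qed
    then have "(\<Sum>i\<le>l. ?a i * ?b (l - i)) = (\<Sum>i\<le>l. (-1) ^ l * z ^ l * hchain r k i)"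
      by (intro sum.cong) auto
    then show "(\<Sum>i\<le>l. ?a i * ?b (l - i)) = (-1) ^ l * (\<Sum>i\<le>l. hchain r k i) * z ^ l"
      by (simp add: sum_distrib_left mult_ac)
  qed
  have "(\<lambda>l. \<Sum>i\<le>l. ?a i * ?b (l - i)) sums ((\<Sum>l. ?a l) * (\<Sum>l. ?b l))"
    by (rule Cauchy_product_sums[OF summable_hpow(2)[OF assms] b])
  moreover have "(\<Sum>l. ?b l) = 1 / (1 + z)" using assms by (subst suminf_geometric) auto
  ultimately show ?thesis unfolding eq hpow_def by simp
qed

text \<open>Termwise differentiation in \<open>z = t^2\<close>, combined with the product rule:
  \<open>t\<close> times the derivative multiplies the term of degree \<open>2 * l + r\<close> by
  that degree.\<close>

lemma has_derivative_shifted_even_powser: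
  fixes c :: "nat \<Rightarrow> real"
  assumes c: "summable c" and t: "0 < t" "t < 1"
    and s: "(\<lambda>l. real (2 * l + r) * c l * (t\<^sup>2) ^ l) sums S"
  shows "((\<lambda>t. t ^ r * (\<Sum>l. c l * (t\<^sup>2) ^ l)) has_real_derivative t ^ r * S / t) (at t)"
proof -
  have c1: "summable (\<lambda>l. c l * 1 ^ l)" using c by simp
  have z: "norm (t\<^sup>2) < norm (1::real)" using t by (simp add: power_less_one_iff abs_square_less_1)
  let ?P = "\<lambda>z. \<Sum>l. c l * z ^ l"
  define D where "D = (\<Sum>l. diffs c l * (t\<^sup>2) ^ l)"
  have P: "(?P has_real_derivative D) (at (t\<^sup>2))"
    unfolding D_def by (rule termdiffs_strong[OF c1 z])
  have sc: "(\<lambda>l. c l * (t\<^sup>2) ^ l) sums ?P (t\<^sup>2)"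
    using powser_inside[OF c1 z] by (rule summable_sums)
  have "summable (\<lambda>l. diffs c l * (t\<^sup>2) ^ l)"
    by (rule termdiff_converges[where K = 1]) (use z powser_inside[OF c1] in auto)
  then have "(\<lambda>l. real l * c l * (t\<^sup>2) ^ (l - Suc 0)) sums D"
    unfolding D_def using diffs_equiv[of c "t\<^sup>2"] by simp
  then have "(\<lambda>l. t\<^sup>2 * (real l * c l * (t\<^sup>2) ^ (l - Suc 0))) sums (t\<^sup>2 * D)" by (rule sums_mult)
  moreover have "t\<^sup>2 * (real l * c l * (t\<^sup>2) ^ (l - Suc 0)) = real l * c l * (t\<^sup>2) ^ l" for l
    by (cases l) auto
  ultimately have "(\<lambda>l. real l * c l * (t\<^sup>2) ^ l) sums (t\<^sup>2 * D)" by simp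
  then have "(\<lambda>l. 2 * (real l * c l * (t\<^sup>2) ^ l) + real r * (c l * (t\<^sup>2) ^ l)) sums (2 * (t\<^sup>2 * D) + real r * ?P (t\<^sup>2))"
    by (intro sums_add sums_mult sc)
  then have "(\<lambda>l. real (2 * l + r) * c l * (t\<^sup>2) ^ l) sums (2 * (t\<^sup>2 * D) + real r * ?P (t\<^sup>2))"
    by (simp add: algebra_simps)
  with s have S: "S = 2 * (t\<^sup>2 * D) + real r * ?P (t\<^sup>2)" by (rule sums_unique2)
  have "((\<lambda>t. t ^ r * ?P (t\<^sup>2)) has_real_derivative
      real r * t ^ (r - Suc 0) * ?P (t\<^sup>2) + D * (2 * t) * t ^ r) (at t)"
    by (rule DERIV_mult[OF DERIV_pow[where n = r, THEN DERIV_cong] DERIV_chain2[where f = ?P and g = "\<lambda>t. t\<^sup>2", OF P], THEN DERIV_cong])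
      (auto intro!: derivative_eq_intros)
  moreover have "real r * t ^ (r - Suc 0) * ?P (t\<^sup>2) + D * (2 * t) * t ^ r = t ^ r * S / t"
    using t unfolding S by (cases r) (simp_all add: field_simps power2_eq_square)
  ultimately show ?thesis by simp
qed

text \<open>Clearing the denominator \<open>2 * l + Suc r\<close> in the recursion of
  \<open>hchain\<close> leaves the series with \<open>k\<close> lowered and twice the partial sums
  at level \<open>r\<close>. The functions are thus iterated integrals of the forms
  \<open>1 / t\<close> and \<open>2 / (1 + t^2)\<close>.\<close>

lemma hgen_has_derivative:
  assumes t: "0 < t" "t < 1"
  shows "(hgen (Suc r) k has_real_derivative
    (if k = 0 then 0 else 1 / t * hgen (Suc r) (k - 1) t) + 2 / (1 + t\<^sup>2) * hgen r k t) (at t)"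
proof -
  have z: "\<bar>t\<^sup>2\<bar> < 1" using t by (simp add: power_less_one_iff abs_square_less_1)
  define A where "A = (if k = 0 then 0 else hpow (Suc r) (k - 1) (t\<^sup>2))"
  have A: "(\<lambda>l. (if k = 0 then 0 else (-1) ^ l * hchain (Suc r) (k - 1) l * (t\<^sup>2) ^ l)) sums A"
    unfolding A_def hpow_def using summable_sums[OF summable_hpow(1)[OF z]] by auto
  have "(\<lambda>l. (if k = 0 then 0 else (-1) ^ l * hchain (Suc r) (k - 1) l * (t\<^sup>2) ^ l)
      + 2 * ((-1) ^ l * (\<Sum>i\<le>l. hchain r k i) * (t\<^sup>2) ^ l)) sums (A + 2 * (hpow r k (t\<^sup>2) / (1 + t\<^sup>2)))"
    by (intro sums_add sums_mult A hpow_partial_sums z)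
  moreover have "(if k = 0 then 0 else (-1) ^ l * hchain (Suc r) (k - 1) l * (t\<^sup>2) ^ l)
      + 2 * ((-1) ^ l * (\<Sum>i\<le>l. hchain r k i) * (t\<^sup>2) ^ l)
      = real (2 * l + Suc r) * ((-1) ^ l * hchain (Suc r) k l) * (t\<^sup>2) ^ l" for l
  proof -
    have "real (2 * l + Suc r) * hchain (Suc r) k l =
        (if k = 0 then 0 else hchain (Suc r) (k - 1) l) + 2 * (\<Sum>i\<le>l. hchain r k i)"
      by (cases k) (simp_all add: field_simps)
    then have "real (2 * l + Suc r) * ((-1) ^ l * hchain (Suc r) k l) * (t\<^sup>2) ^ l =
        ((if k = 0 then 0 else hchain (Suc r) (k - 1) l) + 2 * (\<Sum>i\<le>l. hchain r k i)) * ((-1) ^ l * (t\<^sup>2) ^ l)"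
      by (simp only: mult_ac)
    then show ?thesis by (simp add: algebra_simps)
  qed
  ultimately have "(\<lambda>l. real (2 * l + Suc r) * ((-1) ^ l * hchain (Suc r) k l) * (t\<^sup>2) ^ l)
      sums (A + 2 * (hpow r k (t\<^sup>2) / (1 + t\<^sup>2)))" by simp
  from has_derivative_shifted_even_powser[OF summable_alternating_hchain t this]
  have "(hgen (Suc r) k has_real_derivative
      t ^ Suc r * (A + 2 * (hpow r k (t\<^sup>2) / (1 + t\<^sup>2))) / t) (at t)"
    unfolding hgen_def hpow_def .
  moreover have "t ^ Suc r * (A + 2 * (hpow r k (t\<^sup>2) / (1 + t\<^sup>2))) / t =
      (if k = 0 then 0 else 1 / t * hgen (Suc r) (k - 1) t) + 2 / (1 + t\<^sup>2) * hgen r k t"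
  proof -
    have "t ^ Suc r * (A + 2 * (hpow r k (t\<^sup>2) / (1 + t\<^sup>2))) / t
        = t ^ r * A + 2 / (1 + t\<^sup>2) * (t ^ r * hpow r k (t\<^sup>2))"
    proof -
      have eq: "t ^ Suc r * y / t = t ^ r * y" for y using t by simp
      show ?thesis unfolding eq by (simp add: distrib_left mult_ac)
    qed
    moreover have "t ^ r * A = (if k = 0 then 0 else 1 / t * hgen (Suc r) (k - 1) t)"
      using t by (simp add: A_def hgen_def)
    ultimately show ?thesis by (simp add: hgen_def)
  qed
  ultimately show ?thesis by simp
qed

text \<open>For \<open>k = 0\<close> only the form \<open>2 / (1 + t^2)\<close> occurs, and iterated
  integrals of a single form are divided powers of its primitive.\<close>

lemma hgen_eq_arctan:
  assumes "0 \<le> t" "t < 1"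
  shows "hgen r 0 t = (2 * arctan t) ^ r / fact r"
  using assms
proof (induction r arbitrary: t)
  case 0
  show ?case by (simp add: hgen_0)
next
  case (Suc r)
  show ?case
  proof (cases "t = 0")
    case True
    then show ?thesis by (simp add: hgen_def)
  next
    case False
    define f where "f = (\<lambda>t. hgen (Suc r) 0 t - (2 * arctan t) ^ Suc r / fact (Suc r))"
    have "f t = f 0"
    proof (rule DERIV_isconst_end[where f = f])
      show "0 < t" using False Suc.prems by simp
      show "continuous_on {0..t} f"
        unfolding f_def using Suc.prems
        by (intro continuous_intros continuous_on_subset[OF continuous_on_hgen]) auto
    next
      fix x assume x: "0 < x" "x < t"
      have x1: "0 < x" "x < 1" using x Suc.prems by auto
      have "((\<lambda>t. (2 * arctan t) ^ Suc r / fact (Suc r)) has_real_derivative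
          (real (Suc r) * (2 * arctan x) ^ r * (2 * inverse (1 + x\<^sup>2))) / fact (Suc r)) (at x)"
        by (rule derivative_eq_intros refl | simp)+
      moreover have "(real (Suc r) * (2 * arctan x) ^ r * (2 * inverse (1 + x\<^sup>2))) / fact (Suc r)
          = 2 / (1 + x\<^sup>2) * hgen r 0 x"
        using Suc.IH[of x] x1 by (simp add: fact_Suc divide_inverse mult_ac del: of_nat_Suc)
      ultimately show "(f has_real_derivative 0) (at x)"
        unfolding f_def using hgen_has_derivative[OF x1, of r 0]
        by (auto intro!: DERIV_diff[THEN DERIV_cong])
    qed
    then show ?thesis by (simp add: f_def hgen_def)
  qed
qed

text \<open>Repeated integration by parts in closed form. Each divided power of \<open>a\<close>
  differentiates to \<open>- \<phi>\<close> times the preceding one, which cancels the contribution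
  of \<open>f (j - 1)\<close> to the derivative of \<open>f j\<close>; only the terms
  \<open>h j\<close> remain.\<close>

lemma has_derivative_divided_power_telescope:
  fixes f :: "nat \<Rightarrow> real \<Rightarrow> real"
  assumes f: "\<And>j. j \<le> k \<Longrightarrow> (f j has_real_derivative (if j = 0 then 0 else \<phi> * f (j - 1) x) + h j) (at x)"
    and a: "(a has_real_derivative - \<phi>) (at x)"
  shows "((\<lambda>x. \<Sum>j\<le>k. f j x * (a x ^ (k - j) / fact (k - j))) has_real_derivative
    (\<Sum>j\<le>k. h j * (a x ^ (k - j) / fact (k - j)))) (at x)"
proof -
  let ?E = "\<lambda>n. a x ^ n / fact n"
  let ?E' = "\<lambda>n. if n = 0 then 0 else - \<phi> * ?E (n - 1)"
  have E: "((\<lambda>x. a x ^ n / fact n) has_real_derivative ?E' n) (at x)" for n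
  proof (cases n)
    case (Suc m)
    have "((\<lambda>x. a x ^ n / fact n) has_real_derivative (real n * (- \<phi> * a x ^ (n - Suc 0))) / fact n) (at x)"
      by (intro DERIV_cdivide DERIV_power a)
    then show ?thesis by (rule DERIV_cong) (simp add: Suc fact_Suc mult.assoc del: of_nat_Suc)
  qed auto
  have "((\<lambda>x. \<Sum>j\<le>k. f j x * (a x ^ (k - j) / fact (k - j))) has_real_derivative
      (\<Sum>j\<le>k. ((if j = 0 then 0 else \<phi> * f (j - 1) x) + h j) * ?E (k - j) + ?E' (k - j) * f j x)) (at x)"
    by (intro DERIV_sum DERIV_mult f E) auto
  moreover have "(\<Sum>j\<le>k. ((if j = 0 then 0 else \<phi> * f (j - 1) x) + h j) * ?E (k - j) + ?E' (k - j) * f j x)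
      = (\<Sum>j\<le>k. h j * ?E (k - j)) + ((\<Sum>j\<le>k. (if j = 0 then 0 else \<phi> * f (j - 1) x) * ?E (k - j))
         + (\<Sum>j\<le>k. ?E' (k - j) * f j x))"
    by (simp add: sum.distrib algebra_simps)
  moreover have "(\<Sum>j\<le>k. (if j = 0 then 0 else \<phi> * f (j - 1) x) * ?E (k - j)) = (\<Sum>j<k. \<phi> * f j x * ?E (k - Suc j))"
    by (cases k) (simp_all add: sum.atMost_Suc_shift lessThan_Suc_atMost del: sum.atMost_Suc)
  moreover have "(\<Sum>j\<le>k. ?E' (k - j) * f j x) = - (\<Sum>j<k. \<phi> * f j x * ?E (k - Suc j))"
    by (simp add: lessThan_Suc_atMost[symmetric] sum_negf[symmetric]) (intro sum.cong, auto)
  ultimately show ?thesis by simp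
qed

section \<open>Integral representations\<close>

text \<open>Only the point 0 is critical: the value there is 0, and with \<open>x = - ln s\<close>
  the limit is that of \<open>x ^ q / exp x\<close> at infinity.\<close>

lemma continuous_on_id_times_ln_power: "continuous_on {0..1::real} (\<lambda>s. s * (- ln s) ^ q)"
proof -
  have "((\<lambda>s. s * (- ln s) ^ q) \<longlongrightarrow> 0) (at_right (0::real))"
  proof -
    have "filterlim (\<lambda>s. - ln s) at_top (at_right (0::real))"
      using ln_at_0 by (simp add: filterlim_uminus_at_bot)
    from filterlim_compose[OF tendsto_power_div_exp_0 this, of q]
    have *: "((\<lambda>s. (- ln s) ^ q / exp (- ln s)) \<longlongrightarrow> 0) (at_right (0::real))" .
    have "eventually (\<lambda>s. (- ln s) ^ q / exp (- ln s) = s * (- ln s) ^ q) (at_right (0::real))"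
      unfolding eventually_at_filter by (intro always_eventually) (auto simp: exp_minus field_simps)
    with * show ?thesis by (rule Lim_transform_eventually)
  qed
  then have "((\<lambda>s. s * (- ln s) ^ q) \<longlongrightarrow> 0) (at 0 within {0..1::real})"
    by (simp add: at_within_Icc_at_right)
  moreover have "((\<lambda>s. s * (- ln s) ^ q) \<longlongrightarrow> x * (- ln x) ^ q) (at x within {0..1})" if "0 < x" for x :: real
    using that by (intro tendsto_intros) auto
  ultimately have "((\<lambda>s. s * (- ln s) ^ q) \<longlongrightarrow> x * (- ln x) ^ q) (at x within {0..1})" if "x \<in> {0..1}" for x :: real
    using that by (cases "x = 0") auto
  then show ?thesis unfolding continuous_on_def by blast
qed

definition Lam :: "real \<Rightarrow> real" where
  "Lam t = ln ((1 + t) / (1 - t))"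

text \<open>Both functions are made so that differentiation telescopes, while at \<open>s = 1\<close> all terms but the last
  vanish; at \<open>s = 0\<close> the convention \<open>ln 0 = 0\<close> agrees with the limit.\<close>

definition hlog :: "nat \<Rightarrow> nat \<Rightarrow> real \<Rightarrow> real" where
  "hlog r k s = (\<Sum>j\<le>k. hgen r j s * ((- ln s) ^ (k - j) / fact (k - j)))"

definition hlogarc :: "nat \<Rightarrow> nat \<Rightarrow> real \<Rightarrow> real" where
  "hlogarc r k s = (\<Sum>i\<le>r. hlog (Suc i) k s * ((pi / 2 - 2 * arctan s) ^ (r - i) / fact (r - i)))"

lemma hlog_0: "hlog 0 k s = (- ln s) ^ k / fact k"
proof -
  have "hlog 0 k s = (\<Sum>j\<le>k. if j = 0 then (- ln s) ^ k / fact k else 0)"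
    unfolding hlog_def
  proof (intro sum.cong refl)
    fix j
    show "hgen 0 j s * ((- ln s) ^ (k - j) / fact (k - j)) = (if j = 0 then (- ln s) ^ k / fact k else 0)"
      by (cases j) (auto simp: hgen_0)
  qed
  then show ?thesis by simp
qed

text \<open>A positive level provides a factor \<open>s\<close>, which compensates the powers of the
  logarithm at 0.\<close>

lemma continuous_on_hlog: "continuous_on {0..1} (hlog (Suc r) k)"
proof -
  have "continuous_on {0..1} (\<lambda>s. s ^ r * hpow (Suc r) j (s\<^sup>2) * (s * (- ln s) ^ (k - j)) / fact (k - j))" for j
    by (intro continuous_intros continuous_on_compose2[OF continuous_on_hpow] continuous_on_id_times_ln_power)
      (auto simp: power_le_one)
  then have "continuous_on {0..1} (\<lambda>s. \<Sum>j\<le>k. s ^ r * hpow (Suc r) j (s\<^sup>2) * (s * (- ln s) ^ (k - j)) / fact (k - j))"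
    by (intro continuous_on_sum)
  then show ?thesis unfolding hlog_def hgen_def by (simp add: mult_ac)
qed

lemma continuous_on_hlogarc: "continuous_on {0..1} (hlogarc r k)"
  unfolding hlogarc_def by (intro continuous_intros continuous_on_hlog) auto

text \<open>First telescoping: multiplying by divided powers of \<open>- ln s\<close> eliminates the
  form \<open>1 / s\<close>.\<close>

lemma hlog_has_derivative:
  assumes "0 < s" "s < 1"
  shows "(hlog (Suc r) k has_real_derivative 2 / (1 + s\<^sup>2) * hlog r k s) (at s)"
proof -
  have "(hlog (Suc r) k has_real_derivative
      (\<Sum>j\<le>k. 2 / (1 + s\<^sup>2) * hgen r j s * ((- ln s) ^ (k - j) / fact (k - j)))) (at s)"
    unfolding hlog_def
  proof (rule has_derivative_divided_power_telescope[where \<phi> = "1 / s"])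
    show "((\<lambda>s. - ln s) has_real_derivative - (1 / s)) (at s)"
      using assms by (auto intro!: derivative_eq_intros)
  qed (rule hgen_has_derivative[OF assms])
  then show ?thesis by (simp add: hlog_def sum_distrib_left mult.assoc)
qed

text \<open>Second telescoping: divided powers of \<open>pi / 2 - 2 * arctan s\<close> eliminate the
  form \<open>2 / (1 + s^2)\<close> as well. Only \<open>i = 0\<close> contributes, where the level
  below is the explicit function \<open>hlog 0 k\<close>.\<close>

lemma hlogarc_has_derivative:
  assumes "0 < s" "s < 1"
  shows "(hlogarc r k has_real_derivative
    2 / (1 + s\<^sup>2) * ((- ln s) ^ k / fact k) * ((pi / 2 - 2 * arctan s) ^ r / fact r)) (at s)"
proof -
  let ?h = "\<lambda>i. if i = 0 then 2 / (1 + s\<^sup>2) * ((- ln s) ^ k / fact k) else 0"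
  have "(hlogarc r k has_real_derivative
      (\<Sum>i\<le>r. ?h i * ((pi / 2 - 2 * arctan s) ^ (r - i) / fact (r - i)))) (at s)"
    unfolding hlogarc_def
  proof (rule has_derivative_divided_power_telescope[where \<phi> = "2 / (1 + s\<^sup>2)" and h = ?h
        and f = "\<lambda>i. hlog (Suc i) k" and a = "\<lambda>s. pi / 2 - 2 * arctan s"])
    show "((\<lambda>s. pi / 2 - 2 * arctan s) has_real_derivative - (2 / (1 + s\<^sup>2))) (at s)"
      by (rule DERIV_diff[OF DERIV_const DERIV_cmult[OF DERIV_arctan], THEN DERIV_cong])
        (simp only: divide_inverse diff_0)
    fix i
    show "(hlog (Suc i) k has_real_derivative
        (if i = 0 then 0 else 2 / (1 + s\<^sup>2) * hlog (Suc (i - 1)) k s) + ?h i) (at s)"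
      using hlog_has_derivative[OF assms, of i k] by (cases i) (auto simp: hlog_0)
  qed
  moreover have "(\<Sum>i\<le>r. ?h i * ((pi / 2 - 2 * arctan s) ^ (r - i) / fact (r - i)))
      = (\<Sum>i\<le>r. if i = 0 then 2 / (1 + s\<^sup>2) * ((- ln s) ^ k / fact k) * ((pi / 2 - 2 * arctan s) ^ r / fact r) else 0)"
    by (intro sum.cong) auto
  ultimately show ?thesis by simp
qed

lemma hlogarc_0: "hlogarc r k 0 = 0"
  by (simp add: hlogarc_def hlog_def hgen_def)

lemma hlogarc_1: "hlogarc r k 1 = (\<Sum>l. (-1) ^ l * hchain (Suc r) k l)"
proof -
  have hl: "hlog i k 1 = hgen i k 1" for i
  proof -
    have "hlog i k 1 = (\<Sum>j\<le>k. if j = k then hgen i k 1 else 0)"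
      unfolding hlog_def by (intro sum.cong) auto
    then show ?thesis by simp
  qed
  have "hlogarc r k 1 = (\<Sum>i\<le>r. if i = r then hgen (Suc r) k 1 else 0)"
    unfolding hlogarc_def by (intro sum.cong) (auto simp: hl arctan_one)
  then show ?thesis by (simp add: hgen_def hpow_def)
qed

text \<open>The map \<open>(1 - t) / (1 + t)\<close> swaps the end points and has derivative
  \<open>- 2 / (1 + t)^2\<close>, so the two signs cancel. Applying the fundamental theorem to the
  composed antiderivative avoids any integrability question for \<open>f\<close>.\<close>

lemma has_integral_compose_moebius:
  fixes F f :: "real \<Rightarrow> real"
  assumes cont: "continuous_on {0..1} F"
    and deriv: "\<And>s. 0 < s \<Longrightarrow> s < 1 \<Longrightarrow> (F has_real_derivative f s) (at s)"
  shows "((\<lambda>t. f ((1 - t) / (1 + t)) * (2 / (1 + t)\<^sup>2)) has_integral F 1 - F 0) {0<..<1}"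
proof -
  define u where "u = (\<lambda>t::real. (1 - t) / (1 + t))"
  have u01: "u t \<in> {0..1}" if "t \<in> {0..1}" for t using that by (auto simp: u_def)
  have cu: "continuous_on {0..1} u" unfolding u_def by (intro continuous_intros) auto
  have "((\<lambda>t. f (u t) * (2 / (1 + t)\<^sup>2)) has_integral (- F (u 1)) - (- F (u 0))) {0..1}"
  proof (rule fundamental_theorem_of_calculus_interior)
    show "continuous_on {0..1} (\<lambda>t. - F (u t))"
      by (intro continuous_intros continuous_on_compose2[OF cont cu]) (use u01 in auto)
  next
    fix t :: real assume t: "t \<in> {0<..<1}"
    have "(u has_real_derivative - (2 / (1 + t)\<^sup>2)) (at t)"
      unfolding u_def using t
      by (auto intro!: derivative_eq_intros simp: power2_eq_square divide_simps)
    moreover have "0 < u t" "u t < 1" using t by (auto simp: u_def)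
    ultimately have "((\<lambda>t. F (u t)) has_real_derivative f (u t) * - (2 / (1 + t)\<^sup>2)) (at t)"
      using DERIV_chain2[OF deriv] by blast
    then have "((\<lambda>t. - F (u t)) has_real_derivative f (u t) * (2 / (1 + t)\<^sup>2)) (at t)"
      using DERIV_minus by fastforce
    then show "((\<lambda>t. - F (u t)) has_vector_derivative f (u t) * (2 / (1 + t)\<^sup>2)) (at t)"
      by (simp add: has_real_derivative_iff_has_vector_derivative)
  qed simp
  then show ?thesis by (simp add: u_def has_integral_Icc_iff_Ioo)
qed

lemma neg_ln_moebius: "0 < t \<Longrightarrow> t < 1 \<Longrightarrow> - ln ((1 - t) / (1 + t)) = Lam t"
  by (simp add: Lam_def ln_div)

lemma arctan_moebius: "0 < t \<Longrightarrow> t < 1 \<Longrightarrow> pi / 2 - 2 * arctan ((1 - t) / (1 + t)) = 2 * arctan t"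
  using arctan_add[of 1 "- t"] by (simp add: arctan_one arctan_minus)

text \<open>The substitution transports the derivative of \<open>hlogarc\<close> to the variable in
  which the moments and the arctangent series live.\<close>

lemma has_integral_hchain:
  "((\<lambda>t. 2 / (1 + t\<^sup>2) * (Lam t ^ k / fact k) * ((2 * arctan t) ^ r / fact r)) has_integral
    (\<Sum>l. (-1) ^ l * hchain (Suc r) k l)) {0<..<1}"
proof -
  let ?f = "\<lambda>s. 2 / (1 + s\<^sup>2) * ((- ln s) ^ k / fact k) * ((pi / 2 - 2 * arctan s) ^ r / fact r)"
  have "((\<lambda>t. ?f ((1 - t) / (1 + t)) * (2 / (1 + t)\<^sup>2)) has_integral hlogarc r k 1 - hlogarc r k 0) {0<..<1}"
    by (rule has_integral_compose_moebius[OF continuous_on_hlogarc hlogarc_has_derivative])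
  moreover have "?f ((1 - t) / (1 + t)) * (2 / (1 + t)\<^sup>2)
      = 2 / (1 + t\<^sup>2) * (Lam t ^ k / fact k) * ((2 * arctan t) ^ r / fact r)" if "t \<in> {0<..<1}" for t
  proof -
    \<comment> \<open>The form \<open>2 / (1 + t^2)\<close> is invariant under the substitution, up
      to orientation.\<close>
    have "2 / (1 + ((1 - t) / (1 + t))\<^sup>2) * (2 / (1 + t)\<^sup>2) = 4 / ((1 + ((1 - t) / (1 + t))\<^sup>2) * (1 + t)\<^sup>2)"
      by simp
    also have "(1 + ((1 - t) / (1 + t))\<^sup>2) * (1 + t)\<^sup>2 = (1 + t)\<^sup>2 + (1 - t)\<^sup>2"
      using that by (simp add: distrib_right power_divide)
    also have "4 / ((1 + t)\<^sup>2 + (1 - t)\<^sup>2) = 2 / (1 + t\<^sup>2)"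
    proof -
      have "(1 + t)\<^sup>2 + (1 - t)\<^sup>2 = 2 * (1 + t\<^sup>2)" by (simp add: power2_eq_square algebra_simps)
      moreover have "4 / (2 * x) = 2 / x" for x :: real by simp
      ultimately show ?thesis by (simp only:)
    qed
    finally have J: "2 / (1 + ((1 - t) / (1 + t))\<^sup>2) * (2 / (1 + t)\<^sup>2) = 2 / (1 + t\<^sup>2)" .
    have "?f ((1 - t) / (1 + t)) * (2 / (1 + t)\<^sup>2) = 2 / (1 + ((1 - t) / (1 + t))\<^sup>2) * (2 / (1 + t)\<^sup>2)
        * (Lam t ^ k / fact k) * ((2 * arctan t) ^ r / fact r)"
      using that by (simp only: neg_ln_moebius arctan_moebius greaterThanLessThan_iff mult_ac)
    then show ?thesis unfolding J .
  qed
  ultimately have "((\<lambda>t. 2 / (1 + t\<^sup>2) * (Lam t ^ k / fact k) * ((2 * arctan t) ^ r / fact r)) has_integral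
      hlogarc r k 1 - hlogarc r k 0) {0<..<1}"
    by (simp only: cong: has_integral_cong)
  then show ?thesis by (simp only: hlogarc_0 hlogarc_1 diff_zero)
qed

section \<open>Integrals of powers of \<open>Lam\<close> as alternating zeta values\<close>

lemma zetabar_sums:
  assumes "s \<ge> 1"
  shows "(\<lambda>n. (-1) ^ n / real (n + 1) ^ s) sums zetabar s"
proof -
  have "summable (\<lambda>n. (-1) ^ n * (1 / real (n + 1) ^ s))"
  proof (rule summable_Leibniz(1)[OF _ decseq_imp_monoseq[OF decseq_SucI]])
    show "(\<lambda>n. 1 / real (n + 1) ^ s) \<longlonglongrightarrow> 0"
    proof (rule Lim_null_comparison)
      show "eventually (\<lambda>n. norm (1 / real (n + 1) ^ s) \<le> inverse (real (Suc n))) sequentially"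
      proof (intro always_eventually allI)
        fix n
        have "real (n + 1) ^ 1 \<le> real (n + 1) ^ s" using assms by (intro power_increasing) auto
        then have "inverse (real (n + 1) ^ s) \<le> inverse (real (n + 1) ^ 1)"
          by (intro le_imp_inverse_le) auto
        then show "norm (1 / real (n + 1) ^ s) \<le> inverse (real (Suc n))"
          by (simp add: divide_inverse)
      qed
    qed (rule LIMSEQ_inverse_real_of_nat)
    show "1 / real (Suc n + 1) ^ s \<le> 1 / real (n + 1) ^ s" for n
      by (intro divide_left_mono power_mono) auto
  qed
  then show ?thesis using assms by (simp add: zetabar_def summable_sums)
qed

text \<open>The negated polylogarithm of order \<open>j\<close> at \<open>- s\<close>. Order 0 is
  given in closed form because its series diverges at \<open>s = 1\<close>.\<close>

definition eta_series :: "nat \<Rightarrow> real \<Rightarrow> real" where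
  "eta_series j s = (if j = 0 then s / (1 + s) else s * (\<Sum>n. (-1) ^ n / real (n + 1) ^ j * s ^ n))"

lemma continuous_on_eta_series: "continuous_on {0..1} (\<lambda>s. \<Sum>n. (-1) ^ n / real (n + 1) ^ Suc j * s ^ n)"
  by (rule Abel_limit_continuous_on) (rule sums_summable[OF zetabar_sums], simp)

lemma eta_series_has_derivative:
  assumes "0 < s" "s < 1"
  shows "(eta_series j has_real_derivative
    (if j = 0 then 0 else 1 / s * eta_series (j - 1) s) + (if j = 0 then 1 / (1 + s)\<^sup>2 else 0)) (at s)"
proof (cases j)
  case 0
  have "((\<lambda>s. s / (1 + s)) has_real_derivative 1 / (1 + s)\<^sup>2) (at s)"
    using assms by (auto intro!: derivative_eq_intros simp: power2_eq_square)
  then show ?thesis by (simp add: 0 eta_series_def[abs_def])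
next
  case (Suc i)
  let ?c = "\<lambda>n. (-1) ^ n / real (n + 1) ^ j"
  have c1: "summable (\<lambda>n. ?c n * 1 ^ n)"
    using sums_summable[OF zetabar_sums[of j]] Suc by simp
  have s: "norm s < norm (1::real)" using assms by simp
  define D where "D = (\<Sum>l. diffs ?c l * s ^ l)"
  have P: "((\<lambda>s. \<Sum>n. ?c n * s ^ n) has_real_derivative D) (at s)"
    unfolding D_def by (rule termdiffs_strong[OF c1 s])
  have sc: "(\<lambda>n. ?c n * s ^ n) sums (\<Sum>n. ?c n * s ^ n)"
    using powser_inside[OF c1 s] by (rule summable_sums)
  have "summable (\<lambda>l. diffs ?c l * s ^ l)"
    by (rule termdiff_converges[where K = 1]) (use s powser_inside[OF c1] in auto)
  then have "(\<lambda>n. real n * ?c n * s ^ (n - Suc 0)) sums D"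
    unfolding D_def using diffs_equiv[of ?c s] by simp
  then have "(\<lambda>n. s * (real n * ?c n * s ^ (n - Suc 0))) sums (s * D)" by (rule sums_mult)
  moreover have "(\<lambda>n. s * (real n * ?c n * s ^ (n - Suc 0))) = (\<lambda>n. real n * ?c n * s ^ n)"
  proof
    show "s * (real n * ?c n * s ^ (n - Suc 0)) = real n * ?c n * s ^ n" for n
      by (cases n) auto
  qed
  ultimately have "(\<lambda>n. real n * ?c n * s ^ n) sums (s * D)" by (simp only:)
  then have "(\<lambda>n. real n * ?c n * s ^ n + ?c n * s ^ n) sums (s * D + (\<Sum>n. ?c n * s ^ n))"
    using sc by (rule sums_add)
  moreover have "real n * ?c n * s ^ n + ?c n * s ^ n = (-1) ^ n / real (n + 1) ^ i * s ^ n" for n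
  proof -
    have "real n * ?c n * s ^ n + ?c n * s ^ n = real (n + 1) * ?c n * s ^ n"
      by (simp only: of_nat_add of_nat_1 distrib_right mult_1_left)
    also have "real (n + 1) * ?c n = (-1) ^ n / real (n + 1) ^ i" by (simp add: Suc del: of_nat_Suc of_nat_add)
    finally show ?thesis .
  qed
  ultimately have S: "(\<lambda>n. (-1) ^ n / real (n + 1) ^ i * s ^ n) sums (s * D + (\<Sum>n. ?c n * s ^ n))" by simp
  have "s * D + (\<Sum>n. ?c n * s ^ n) = 1 / s * eta_series i s"
  proof (cases i)
    case 0
    have "(\<lambda>n. (- s) ^ n) sums (1 / (1 + s))" using geometric_sums[of "- s"] assms by simp
    then have "(\<lambda>n. (-1) ^ n / real (n + 1) ^ i * s ^ n) sums (1 / (1 + s))"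
      by (simp add: 0 power_minus[of s])
    with S have "s * D + (\<Sum>n. ?c n * s ^ n) = 1 / (1 + s)" by (rule sums_unique2)
    then show ?thesis using assms by (simp add: 0 eta_series_def)
  next
    case (Suc m)
    then show ?thesis using sums_unique[OF S] assms by (simp add: eta_series_def)
  qed
  moreover have "(eta_series j has_real_derivative s * D + (\<Sum>n. ?c n * s ^ n)) (at s)"
  proof -
    have "eta_series j = (\<lambda>s. s * (\<Sum>n. ?c n * s ^ n))" using Suc by (simp add: eta_series_def[abs_def])
    then show ?thesis
      by (simp only:) (rule DERIV_mult[OF DERIV_ident P, THEN DERIV_cong], simp only: mult.commute mult_1_left add.commute)
  qed
  ultimately show ?thesis by (simp add: Suc)
qed

text \<open>After the substitution the integrand is \<open>2 / (1 + s)^2\<close> times a divided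
  power of \<open>- ln s\<close>. The telescoped sum of the \<open>eta_series\<close> is an
  antiderivative of half of it; at 1 only the order \<open>k\<close> survives.\<close>

lemma has_integral_Lam_power:
  assumes "k \<ge> 1"
  shows "((\<lambda>t. Lam t ^ k / fact k) has_integral 2 * zetabar k) {0<..<1}"
proof -
  define F where "F = (\<lambda>s. \<Sum>j\<le>k. eta_series j s * ((- ln s) ^ (k - j) / fact (k - j)))"
  let ?f = "\<lambda>s. 1 / (1 + s)\<^sup>2 * ((- ln s) ^ k / fact k)"
  have F: "(F has_real_derivative ?f s) (at s)" if s: "0 < s" "s < 1" for s
  proof -
    have "(F has_real_derivative
        (\<Sum>j\<le>k. (if j = 0 then 1 / (1 + s)\<^sup>2 else 0) * ((- ln s) ^ (k - j) / fact (k - j)))) (at s)"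
      unfolding F_def
    proof (rule has_derivative_divided_power_telescope[where \<phi> = "1 / s"])
      show "((\<lambda>s. - ln s) has_real_derivative - (1 / s)) (at s)"
        using s by (auto intro!: derivative_eq_intros)
    qed (rule eta_series_has_derivative[OF s])
    moreover have "(\<Sum>j\<le>k. (if j = 0 then 1 / (1 + s)\<^sup>2 else 0) * ((- ln s) ^ (k - j) / fact (k - j)))
      = (\<Sum>j\<le>k. if j = 0 then ?f s else 0)" by (intro sum.cong) auto
    ultimately show ?thesis by simp
  qed
  have cont: "continuous_on {0..1} F"
  proof -
    have "continuous_on {0..1} (\<lambda>s. eta_series j s * ((- ln s) ^ (k - j) / fact (k - j)))" for j
    proof -
      have eq: "(\<lambda>s. eta_series j s * ((- ln s) ^ (k - j) / fact (k - j))) =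
        (\<lambda>s. (if j = 0 then 1 / (1 + s) else (\<Sum>n. (-1) ^ n / real (n + 1) ^ j * s ^ n))
            * (s * (- ln s) ^ (k - j)) / fact (k - j))"
        by (auto simp: eta_series_def)
      have "continuous_on {0..1::real} (\<lambda>s. if j = 0 then 1 / (1 + s) else (\<Sum>n. (-1) ^ n / real (n + 1) ^ j * s ^ n))"
        using continuous_on_eta_series[of "j - 1"] by (cases j) (auto intro!: continuous_intros)
      then show ?thesis unfolding eq by (intro continuous_intros continuous_on_id_times_ln_power) auto
    qed
    then show ?thesis unfolding F_def by (intro continuous_on_sum)
  qed
  have "eta_series j 0 = 0" for j by (simp add: eta_series_def)
  then have F0: "F 0 = 0" by (simp add: F_def)
  have F1: "F 1 = zetabar k"
  proof -
    have "F 1 = (\<Sum>j\<le>k. if j = k then eta_series k 1 else 0)"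
      unfolding F_def by (intro sum.cong) auto
    then show ?thesis using assms by (simp add: eta_series_def zetabar_def)
  qed
  have "((\<lambda>t. ?f ((1 - t) / (1 + t)) * (2 / (1 + t)\<^sup>2)) has_integral F 1 - F 0) {0<..<1}"
    by (rule has_integral_compose_moebius[OF cont F])
  then have "((\<lambda>t. 2 * (?f ((1 - t) / (1 + t)) * (2 / (1 + t)\<^sup>2))) has_integral 2 * zetabar k) {0<..<1}"
    unfolding F0 F1 by (intro has_integral_mult_right) simp
  moreover have "2 * (?f ((1 - t) / (1 + t)) * (2 / (1 + t)\<^sup>2)) = Lam t ^ k / fact k" if t: "t \<in> {0<..<1}" for t
  proof -
    have "1 + (1 - t) / (1 + t) = 2 / (1 + t)" using t by (simp add: field_simps)
    then have "1 / (1 + (1 - t) / (1 + t))\<^sup>2 * (2 / (1 + t)\<^sup>2) = 1 / 2"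
      using t by (simp add: power_divide)
    moreover have "2 * (?f ((1 - t) / (1 + t)) * (2 / (1 + t)\<^sup>2)) =
        2 * (1 / (1 + (1 - t) / (1 + t))\<^sup>2 * (2 / (1 + t)\<^sup>2)) * (Lam t ^ k / fact k)"
      using t by (simp only: neg_ln_moebius greaterThanLessThan_iff mult_ac)
    ultimately show ?thesis by simp
  qed
  ultimately show ?thesis by (simp only: cong: has_integral_cong)
qed

section \<open>Moments of powers of the logarithm\<close>

lemma Lam_nonneg: "0 \<le> t \<Longrightarrow> t < 1 \<Longrightarrow> Lam t \<ge> 0"
  by (simp add: Lam_def)

lemma Lam_has_derivative: "0 \<le> t \<Longrightarrow> t < 1 \<Longrightarrow> (Lam has_real_derivative 2 / (1 - t\<^sup>2)) (at t)"
proof -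
  assume t: "0 \<le> t" "t < 1"
  have "((\<lambda>t. ln (1 + t) - ln (1 - t)) has_real_derivative 1 / (1 + t) - - 1 / (1 - t)) (at t)"
    using t by (auto intro!: derivative_eq_intros)
  moreover have "1 / (1 + t) - - 1 / (1 - t) = 2 / (1 - t\<^sup>2)"
  proof -
    have "1 - t\<^sup>2 = (1 + t) * (1 - t)" by (simp add: power2_eq_square algebra_simps)
    then show ?thesis using t by (simp add: field_simps)
  qed
  moreover have "eventually (\<lambda>x. ln (1 + x) - ln (1 - x) = Lam x) (nhds t)"
  proof -
    have "eventually (\<lambda>x. x \<in> {-1<..<1}) (nhds t)" using t by (intro eventually_nhds_in_open) auto
    then show ?thesis by eventually_elim (simp add: Lam_def ln_div)
  qed
  ultimately show ?thesis using DERIV_cong_ev[OF refl _ refl] by fastforce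
qed

lemma continuous_on_Lam_power: "continuous_on {0..1} (\<lambda>t. (1 - t) * Lam t ^ q)"
proof -
  define u where "u = (\<lambda>t::real. (1 - t) / (1 + t))"
  have u01: "u ` {0..1} \<subseteq> {0..1}" by (auto simp: u_def)
  have cu: "continuous_on {0..1} u" unfolding u_def by (intro continuous_intros) auto
  have "continuous_on {0..1} (\<lambda>t. (1 + t) * (u t * (- ln (u t)) ^ q))"
    by (intro continuous_intros continuous_on_compose2[OF continuous_on_id_times_ln_power cu u01])
  moreover have "(1 + t) * (u t * (- ln (u t)) ^ q) = (1 - t) * Lam t ^ q" if "t \<in> {0..1}" for t
  proof -
    have "(1 + t) * u t = 1 - t" using that by (simp add: u_def)
    \<comment> \<open>At \<open>t = 1\<close> both arguments are 0, the one of \<open>Lam\<close>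
      through division by zero, so both sides are 0 by \<open>ln 0 = 0\<close>.\<close>
    moreover have "- ln (u t) = Lam t"
      using that by (cases "t = 1") (auto simp: u_def Lam_def ln_div)
    ultimately show ?thesis by (simp add: mult.assoc[symmetric])
  qed
  ultimately show ?thesis by (metis (no_types, lifting) continuous_on_cong)
qed

lemma absolutely_integrable_Lam_power: "(\<lambda>t. Lam t ^ k / fact k) absolutely_integrable_on {0<..<1}"
proof (rule nonnegative_absolutely_integrable_1)
  show "(\<lambda>t. Lam t ^ k / fact k) integrable_on {0<..<1}"
  proof (cases k)
    case 0
    have "(\<lambda>t::real. 1::real) integrable_on {0<..<1}"
      by (rule integrable_on_Icc_iff_Ioo[THEN iffD1, OF integrable_const_ivl])
    then show ?thesis by (simp add: 0)
  next
    case (Suc m)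
    then show ?thesis using has_integral_Lam_power[of k] by (auto simp: integrable_on_def)
  qed
qed (auto intro!: divide_nonneg_nonneg zero_le_power Lam_nonneg)

lemma integrable_continuous_times_Lam_power:
  assumes "continuous_on {0..1} f"
  shows "(\<lambda>t. f t * (Lam t ^ k / fact k)) integrable_on {0<..<1}"
proof -
  have "f \<in> borel_measurable (lebesgue_on {0<..<1})"
    using assms by (intro continuous_imp_measurable_on_sets_lebesgue) (auto intro: continuous_on_subset)
  moreover have "bounded (f ` {0<..<1})"
    using compact_imp_bounded[OF compact_continuous_image[OF assms compact_Icc]]
    by (rule bounded_subset) auto
  ultimately have "(\<lambda>t. f t * (Lam t ^ k / fact k)) absolutely_integrable_on {0<..<1}"
    by (intro absolutely_integrable_bounded_measurable_product_real absolutely_integrable_Lam_power) auto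
  then show ?thesis by (simp add: absolutely_integrable_on_def)
qed

definition mom :: "nat \<Rightarrow> nat \<Rightarrow> real" where
  "mom n k = integral {0<..<1} (\<lambda>t. t ^ n * (Lam t ^ k / fact k))"

lemma has_integral_mom: "((\<lambda>t. t ^ n * (Lam t ^ k / fact k)) has_integral mom n k) {0<..<1}"
  unfolding mom_def
  by (intro integrable_integral integrable_continuous_times_Lam_power continuous_intros)

text \<open>The convention \<open>zetabar 0 = 1 / 2\<close> includes the case \<open>k = 0\<close>,
  where the integral is 1.\<close>

lemma mom_0_even: "mom 0 (2 * k) = 2 * zetabar (2 * k)"
proof (cases k)
  case 0
  have "((\<lambda>t::real. 1::real) has_integral 1) {0<..<1}"
    using has_integral_const_real[of "1::real" 0 1] has_integral_Icc_iff_Ioo[of "\<lambda>_. 1::real" 1 0 1] by simp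
  then have "mom 0 0 = 1" unfolding mom_def by (simp add: integral_unique)
  then show ?thesis by (simp add: 0 zetabar_def)
next
  case (Suc m)
  then have "((\<lambda>t. t ^ 0 * (Lam t ^ (2 * k) / fact (2 * k))) has_integral 2 * zetabar (2 * k)) {0<..<1}"
    using has_integral_Lam_power[of "2 * k"] by (simp only: power_0 mult_1_left) simp
  then show ?thesis unfolding mom_def by (rule integral_unique)
qed

lemma mom_n_0: "real (Suc n) * mom n 0 = 1"
proof -
  have "((\<lambda>t::real. t ^ n) has_integral 1 ^ Suc n / real (Suc n) - 0 ^ Suc n / real (Suc n)) {0..1}"
  proof (rule fundamental_theorem_of_calculus)
    fix x :: real
    have "((\<lambda>x. x ^ Suc n / real (Suc n)) has_real_derivative real (Suc n) * x ^ (Suc n - Suc 0) / real (Suc n)) (at x within {0..1})"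
      by (intro DERIV_cdivide DERIV_pow)
    then have "((\<lambda>x. x ^ Suc n / real (Suc n)) has_real_derivative x ^ n) (at x within {0..1})"
      by (rule DERIV_cong) (simp del: of_nat_Suc)
    then show "((\<lambda>x. x ^ Suc n / real (Suc n)) has_vector_derivative x ^ n) (at x within {0..1})"
      by (simp only: has_real_derivative_iff_has_vector_derivative)
  qed simp
  then have "mom n 0 = 1 / real (Suc n)"
    unfolding mom_def by (simp add: has_integral_Icc_iff_Ioo integral_unique)
  then show ?thesis by simp
qed

text \<open>Integration by parts, using that \<open>(1 - t\<^sup>2) \<cdot> Lam' t = 2\<close>.\<close>

lemma mom_rec: "real (N + 2) * mom (Suc N) (Suc k) = real N * mom (N - 1) (Suc k) + 2 * mom N k"
proof -
  let ?E = "\<lambda>k t. Lam t ^ k / fact k"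
  define F where "F = (\<lambda>t. (t ^ N - t ^ (N + 2)) * ?E (Suc k) t)"
  have "((\<lambda>t. (real N * t ^ (N - 1) - real (N + 2) * t ^ Suc N) * ?E (Suc k) t + 2 * (t ^ N * ?E k t))
      has_integral F 1 - F 0) {0..1}"
  proof (rule fundamental_theorem_of_calculus_interior)
    have "F = (\<lambda>t. t ^ N * (1 + t) * ((1 - t) * Lam t ^ Suc k) / fact (Suc k))"
      unfolding F_def by (intro ext) (simp add: power2_eq_square algebra_simps)
    then show "continuous_on {0..1} F"
      by (simp only:) (intro continuous_intros continuous_on_Lam_power, auto)
  next
    fix t :: real assume "t \<in> {0<..<1}"
    then have t: "0 \<le> t" "t < 1" by auto
    have t2: "1 - t\<^sup>2 \<noteq> 0" using t by (metis abs_of_nonneg abs_square_less_1 diff_gt_0_iff_gt less_irrefl)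
    have "((\<lambda>t. ?E (Suc k) t) has_real_derivative (real (Suc k) * (2 / (1 - t\<^sup>2) * Lam t ^ (Suc k - Suc 0))) / fact (Suc k)) (at t)"
      by (intro DERIV_cdivide DERIV_power Lam_has_derivative t)
    then have E: "((\<lambda>t. ?E (Suc k) t) has_real_derivative 2 / (1 - t\<^sup>2) * ?E k t) (at t)"
      by (rule DERIV_cong) (simp add: fact_Suc mult.assoc del: of_nat_Suc)
    have P: "((\<lambda>t. t ^ N - t ^ (N + 2)) has_real_derivative real N * t ^ (N - 1) - real (N + 2) * t ^ Suc N) (at t)"
      using DERIV_diff[OF DERIV_pow[of N t] DERIV_pow[of "N + 2" t]] by simp
    have "(t ^ N - t ^ (N + 2)) = t ^ N * (1 - t\<^sup>2)" by (simp add: power_add power2_eq_square right_diff_distrib)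
    then have "2 / (1 - t\<^sup>2) * ?E k t * (t ^ N - t ^ (N + 2)) = 2 * (t ^ N * ?E k t)"
      using t2 by simp
    then have "(F has_real_derivative
        (real N * t ^ (N - 1) - real (N + 2) * t ^ Suc N) * ?E (Suc k) t + 2 * (t ^ N * ?E k t)) (at t)"
      using DERIV_mult[OF P E] unfolding F_def by (simp only:)
    then show "(F has_vector_derivative
        (real N * t ^ (N - 1) - real (N + 2) * t ^ Suc N) * ?E (Suc k) t + 2 * (t ^ N * ?E k t)) (at t)"
      by (simp only: has_real_derivative_iff_has_vector_derivative)
  qed simp
  \<comment> \<open>At 1 the polynomial factor vanishes; at 0 \<open>Lam\<close> does, which covers
    \<open>N = 0\<close>.\<close>
  moreover have "F 1 = 0" "F 0 = 0" by (simp_all add: F_def Lam_def)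
  ultimately have 0: "((\<lambda>t. (real N * t ^ (N - 1) - real (N + 2) * t ^ Suc N) * ?E (Suc k) t + 2 * (t ^ N * ?E k t))
      has_integral 0) {0<..<1}" by (simp only: has_integral_Icc_iff_Ioo diff_self)
  have "((\<lambda>t. real N * (t ^ (N - 1) * ?E (Suc k) t) - real (N + 2) * (t ^ Suc N * ?E (Suc k) t) + 2 * (t ^ N * ?E k t))
      has_integral real N * mom (N - 1) (Suc k) - real (N + 2) * mom (Suc N) (Suc k) + 2 * mom N k) {0<..<1}"
    by (intro has_integral_add has_integral_diff has_integral_mult_right has_integral_mom)
  moreover have "(\<lambda>t. real N * (t ^ (N - 1) * ?E (Suc k) t) - real (N + 2) * (t ^ Suc N * ?E (Suc k) t) + 2 * (t ^ N * ?E k t))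
      = (\<lambda>t. (real N * t ^ (N - 1) - real (N + 2) * t ^ Suc N) * ?E (Suc k) t + 2 * (t ^ N * ?E k t))"
    by (intro ext) (simp only: left_diff_distrib mult.assoc)
  ultimately have "((\<lambda>t. (real N * t ^ (N - 1) - real (N + 2) * t ^ Suc N) * ?E (Suc k) t + 2 * (t ^ N * ?E k t))
      has_integral real N * mom (N - 1) (Suc k) - real (N + 2) * mom (Suc N) (Suc k) + 2 * mom N k) {0<..<1}"
    by (simp only:)
  from has_integral_unique[OF 0 this] show ?thesis by linarith
qed

text \<open>For the normalised moments, \<open>mom_rec\<close> at even and odd \<open>N\<close>
  becomes the recursions of \<open>Todd\<close> and \<open>Tone\<close>. The zeta coefficients are
  the initial values at \<open>n = 0\<close>. Both parities advance together, since the even moment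
  at \<open>Suc n\<close> uses the odd one there.\<close>

lemma mom_eq_Tone:
  "real (2 * n) * mom (2 * n - 1) (2 * k + 1) = (\<Sum>i\<le>k. 2 * zetabar (2 * (k - i)) * Todd i n)"
  "real (2 * n + 1) * mom (2 * n) (2 * k) = (\<Sum>i\<le>k. 2 * zetabar (2 * (k - i)) * Tone i (Suc n))"
proof (induction n arbitrary: k)
  case 0
  {
    case 1
    show ?case by (simp add: Todd_rec)
  next
    case 2
    have "Tone i (Suc 0) = (if i = 0 then 1 else 0)" for i
      by (cases i) (auto simp: Tone_Suc)
    then have "(\<Sum>i\<le>k. 2 * zetabar (2 * (k - i)) * Tone i (Suc 0)) = (\<Sum>i\<le>k. if i = 0 then 2 * zetabar (2 * k) else 0)"
      by (intro sum.cong) auto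
    then show ?case using mom_0_even[of k] by simp
  }
next
  case (Suc n)
  have odd: "real (2 * Suc n) * mom (2 * Suc n - 1) (2 * k + 1)
      = (\<Sum>i\<le>k. 2 * zetabar (2 * (k - i)) * Todd i (Suc n))" for k
  proof -
    have "real (2 * Suc n) * mom (2 * Suc n - 1) (2 * k + 1)
        = real (2 * n) * mom (2 * n - 1) (2 * k + 1) + 2 / (2 * real n + 1) * (real (2 * n + 1) * mom (2 * n) (2 * k))"
    proof -
      have "2 / (2 * real n + 1) * (real (2 * n + 1) * mom (2 * n) (2 * k)) = 2 * mom (2 * n) (2 * k)"
        by (simp add: add.commute)
      then show ?thesis using mom_rec[of "2 * n" "2 * k"] by simp
    qed
    also have "\<dots> = (\<Sum>i\<le>k. 2 * zetabar (2 * (k - i)) * Todd i (Suc n))"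
      unfolding Suc.IH Todd_rec by (simp add: sum_distrib_left sum.distrib[symmetric] algebra_simps)
    finally show ?thesis .
  qed
  {
    case 1
    show ?case by (rule odd)
  next
    case 2
    show ?case
    proof (cases k)
      case 0
      then show ?thesis using mom_n_0[of "2 * Suc n"] by (simp add: zetabar_def)
    next
      case (Suc j)
      have "real (2 * Suc n + 1) * mom (2 * Suc n) (2 * k)
          = real (2 * n + 1) * mom (2 * n) (2 * k) + 2 / (2 * real (Suc n)) * (real (2 * Suc n) * mom (2 * Suc n - 1) (2 * j + 1))"
        using mom_rec[of "2 * n + 1" "2 * j + 1"] by (simp add: Suc)
      also have "\<dots> = (\<Sum>i\<le>k. 2 * zetabar (2 * (k - i)) * Tone i (Suc n))
          + 2 / (2 * real (Suc n)) * (\<Sum>i\<le>j. 2 * zetabar (2 * (j - i)) * Todd i (Suc n))"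
        unfolding Suc.IH odd ..
      also have "\<dots> = (\<Sum>i\<le>k. 2 * zetabar (2 * (k - i)) * Tone i (Suc (Suc n)))"
        \<comment> \<open>The term \<open>i = 0\<close> does not change with \<open>n\<close>, since
          \<open>Tone 0\<close> is constantly 1; the other indices are successors, as
          \<open>Tone_rec\<close> requires.\<close>
        unfolding Suc sum.atMost_Suc_shift Tone_rec[of _ "Suc n"]
        by (simp add: sum_distrib_left sum.distrib[symmetric] algebra_simps)
      finally show ?thesis .
    qed
  }
qed

section \<open>Summing the T sums against the moments by dominated convergence\<close>

lemma power_even_add: "(t::real) ^ (2 * l + r) = t ^ r * (t\<^sup>2) ^ l"
  by (subst power_add, subst power_mult) (rule mult.commute)

text \<open>Finite form of the Cauchy product with a geometric series. It serves for
  \<open>z = x^2\<close> in the majorant and for a negative argument in the alternating partial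
  sums.\<close>

lemma partial_sums_power_identity:
  fixes h :: "nat \<Rightarrow> real"
  shows "(1 - z) * (\<Sum>l<K. (\<Sum>i\<le>l. h i) * z ^ l) = (\<Sum>l<K. h l * z ^ l) - (\<Sum>i<K. h i) * z ^ K"
proof (induction K)
  case (Suc K)
  have "(1 - z) * (\<Sum>l<Suc K. (\<Sum>i\<le>l. h i) * z ^ l)
      = (1 - z) * (\<Sum>l<K. (\<Sum>i\<le>l. h i) * z ^ l) + (1 - z) * ((\<Sum>i<Suc K. h i) * z ^ K)"
    by (simp add: distrib_left lessThan_Suc_atMost del: sum.lessThan_Suc, simp add: distrib_left flip: lessThan_Suc_atMost)
  then show ?case unfolding Suc by (simp add: algebra_simps)
qed simp

text \<open>Without alternating signs the form is \<open>2 / (1 - t^2)\<close>, with primitive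
  \<open>Lam\<close>. Truncation drops a term of favourable sign because the coefficients are
  nonnegative, so comparing derivatives gives an inequality uniform in \<open>K\<close>.\<close>

lemma hchain_partial_le:
  assumes "0 \<le> t" "t < 1"
  shows "(\<Sum>l<K. hchain r 0 l * t ^ (2 * l + r)) \<le> Lam t ^ r / fact r"
  using assms
proof (induction r arbitrary: t)
  case 0
  have "(\<Sum>l<K. hchain 0 0 l * t ^ (2 * l + 0)) = (\<Sum>l<K. if l = 0 then 1 else 0)"
    by (intro sum.cong) auto
  then show ?case by simp
next
  case (Suc r)
  define f where "f = (\<lambda>t. Lam t ^ Suc r / fact (Suc r) - (\<Sum>l<K. hchain (Suc r) 0 l * t ^ (2 * l + Suc r)))"
  have "f 0 \<le> f t"
  proof (rule DERIV_nonneg_imp_nondecreasing[OF Suc.prems(1)])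
    fix x assume "0 \<le> x" "x \<le> t"
    then have x: "0 \<le> x" "x < 1" using Suc.prems by auto
    have x2: "1 - x\<^sup>2 > 0" using x by (metis abs_of_nonneg abs_square_less_1 diff_gt_0_iff_gt)
    have "((\<lambda>t. Lam t ^ Suc r / fact (Suc r)) has_real_derivative (real (Suc r) * (2 / (1 - x\<^sup>2) * Lam x ^ (Suc r - Suc 0))) / fact (Suc r)) (at x)"
      by (intro DERIV_cdivide DERIV_power Lam_has_derivative x)
    then have E: "((\<lambda>t. Lam t ^ Suc r / fact (Suc r)) has_real_derivative 2 / (1 - x\<^sup>2) * (Lam x ^ r / fact r)) (at x)"
      by (rule DERIV_cong) (simp add: fact_Suc mult.assoc del: of_nat_Suc)
    let ?D = "\<Sum>l<K. hchain (Suc r) 0 l * (real (2 * l + Suc r) * x ^ (2 * l + r))"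
    have P: "((\<lambda>t. \<Sum>l<K. hchain (Suc r) 0 l * t ^ (2 * l + Suc r)) has_real_derivative ?D) (at x)"
    proof (intro DERIV_sum DERIV_cmult)
      fix l
      show "((\<lambda>t. t ^ (2 * l + Suc r)) has_real_derivative real (2 * l + Suc r) * x ^ (2 * l + r)) (at x)"
        using DERIV_pow[of "2 * l + Suc r" x] by simp
    qed
    have "?D = 2 * x ^ r * (\<Sum>l<K. (\<Sum>i\<le>l. hchain r 0 i) * (x\<^sup>2) ^ l)"
      unfolding sum_distrib_left
      by (intro sum.cong refl) (simp add: power_add power_mult)
    moreover have "(1 - x\<^sup>2) * (\<Sum>l<K. (\<Sum>i\<le>l. hchain r 0 i) * (x\<^sup>2) ^ l) \<le> (\<Sum>l<K. hchain r 0 l * (x\<^sup>2) ^ l)"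
      unfolding partial_sums_power_identity by (simp add: sum_nonneg hchain_nonneg)
    ultimately have "(1 - x\<^sup>2) * ?D \<le> 2 * x ^ r * (\<Sum>l<K. hchain r 0 l * (x\<^sup>2) ^ l)"
      using mult_left_mono[of _ _ "2 * x ^ r"] x by (simp add: mult.left_commute)
    also have "\<dots> = 2 * (\<Sum>l<K. hchain r 0 l * x ^ (2 * l + r))"
      unfolding sum_distrib_left power_even_add by (simp only: mult_ac)
    also have "\<dots> \<le> 2 * (Lam x ^ r / fact r)" using Suc.IH[OF x] by simp
    finally have "?D \<le> 2 / (1 - x\<^sup>2) * (Lam x ^ r / fact r)" using x2 by (simp add: field_simps)
    then show "\<exists>y. (f has_real_derivative y) (at x) \<and> 0 \<le> y"
      using DERIV_diff[OF E P] unfolding f_def by (intro exI conjI) (assumption, simp)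
  qed
  moreover have "f 0 = 0" by (simp add: f_def Lam_def)
  ultimately have "0 \<le> f t" by simp
  then show ?case unfolding f_def by linarith
qed

text \<open>Here \<open>f K\<close> is the integrand of the \<open>K\<close>-th partial sum,
  \<open>g\<close> its pointwise limit through the arctangent series, and \<open>b\<close> the
  majorant.\<close>

lemma sums_partial_hchain_mom:
  "(\<lambda>l. (-1) ^ l * (\<Sum>i\<le>l. hchain (2 * a) 0 i) * mom (2 * (l + a)) k) sums
    ((\<Sum>l. (-1) ^ l * hchain (Suc (2 * a)) k l) / 2)"
proof -
  let ?E = "\<lambda>t. Lam t ^ k / fact k"
  define X where "X = (\<lambda>l. \<Sum>i\<le>l. hchain (2 * a) 0 i)"
  define f where "f = (\<lambda>K t. \<Sum>l<K. ((-1) ^ l * X l) * (t ^ (2 * (l + a)) * ?E t))"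
  define g where "g = (\<lambda>t. 1 / 2 * (2 / (1 + t\<^sup>2) * ?E t * ((2 * arctan t) ^ (2 * a) / fact (2 * a))))"
  \<comment> \<open>This is \<open>2\<close> times the divided powers of \<open>Lam\<close> of
    orders \<open>2 * a\<close> and \<open>k\<close>, rewritten as a multiple of a single divided
    power, whose integrability is known.\<close>
  define b where "b = (\<lambda>t. 2 * ((fact (2 * a + k) / (fact (2 * a) * fact k)) * (Lam t ^ (2 * a + k) / fact (2 * a + k))))"
  have f: "(f K has_integral (\<Sum>l<K. ((-1) ^ l * X l) * mom (2 * (l + a)) k)) {0<..<1}" for K
    unfolding f_def by (intro has_integral_sum has_integral_mult_right has_integral_mom) auto
  have feq: "f K t = t ^ (2 * a) * (\<Sum>l<K. X l * (- (t\<^sup>2)) ^ l) * ?E t" for K t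
    unfolding f_def sum_distrib_left sum_distrib_right
    by (intro sum.cong refl) (simp only: distrib_left[of 2] power_even_add power_minus[of "t\<^sup>2"], simp only: mult_ac)
  have conv: "(\<lambda>K. f K t) \<longlonglongrightarrow> g t" if "t \<in> {0<..<1}" for t
  proof -
    have t: "0 \<le> t" "t < 1" "\<bar>t\<^sup>2\<bar> < 1" using that by (auto simp: abs_square_less_1)
    have "(\<lambda>l. X l * (- (t\<^sup>2)) ^ l) sums (hpow (2 * a) 0 (t\<^sup>2) / (1 + t\<^sup>2))"
      using hpow_partial_sums[OF t(3), of "2 * a" 0] unfolding X_def
      by (simp add: power_minus[of "t\<^sup>2"] mult_ac)
    then have "(\<lambda>K. \<Sum>l<K. X l * (- (t\<^sup>2)) ^ l) \<longlonglongrightarrow> hpow (2 * a) 0 (t\<^sup>2) / (1 + t\<^sup>2)"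
      by (simp add: sums_def)
    then have "(\<lambda>K. t ^ (2 * a) * (\<Sum>l<K. X l * (- (t\<^sup>2)) ^ l) * ?E t) \<longlonglongrightarrow>
        t ^ (2 * a) * (hpow (2 * a) 0 (t\<^sup>2) / (1 + t\<^sup>2)) * ?E t"
      by (intro tendsto_mult tendsto_const)
    moreover have "t ^ (2 * a) * (hpow (2 * a) 0 (t\<^sup>2) / (1 + t\<^sup>2)) * ?E t = g t"
      using hgen_eq_arctan[OF t(1,2), of "2 * a"] unfolding g_def hgen_def by (simp add: mult_ac)
    ultimately show ?thesis unfolding feq by simp
  qed
  have bound: "norm (f K t) \<le> b t" if "t \<in> {0<..<1}" for K t
  proof -
    have t: "0 \<le> t" "t < 1" using that by auto
    define z where "z = t\<^sup>2"
    have z: "0 \<le> z" "z < 1" using t by (auto simp: z_def abs_square_less_1)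
    let ?S = "\<Sum>l<K. hchain (2 * a) 0 l * z ^ l"
    have "\<bar>\<Sum>l<K. hchain (2 * a) 0 l * (- z) ^ l\<bar> \<le> ?S"
      using z by (intro order_trans[OF sum_abs] sum_mono) (simp add: abs_mult power_abs hchain_nonneg)
    \<comment> \<open>The boundary term obeys the same bound because \<open>z ^ K\<close> is at most
      \<open>z ^ i\<close> for \<open>i < K\<close>; the two bounds give the factor 2 in
      \<open>b\<close>.\<close>
    moreover have "\<bar>(\<Sum>i<K. hchain (2 * a) 0 i) * (- z) ^ K\<bar> \<le> ?S"
    proof -
      have "(\<Sum>i<K. hchain (2 * a) 0 i) * z ^ K \<le> ?S"
        unfolding sum_distrib_right using z
        by (intro sum_mono mult_left_mono hchain_nonneg power_decreasing) auto
      then show ?thesis using z by (simp add: abs_mult power_abs sum_nonneg hchain_nonneg)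
    qed
    ultimately have "\<bar>(1 - (- z)) * (\<Sum>l<K. X l * (- z) ^ l)\<bar> \<le> 2 * ?S"
      unfolding X_def partial_sums_power_identity by linarith
    moreover have "\<bar>\<Sum>l<K. X l * (- z) ^ l\<bar> \<le> \<bar>(1 - (- z)) * (\<Sum>l<K. X l * (- z) ^ l)\<bar>"
      using z mult_right_mono[of 1 "1 + z" "\<bar>\<Sum>l<K. X l * (- z) ^ l\<bar>"] by (simp add: abs_mult)
    ultimately have s: "\<bar>\<Sum>l<K. X l * (- z) ^ l\<bar> \<le> 2 * ?S" by linarith
    have E0: "?E t \<ge> 0" using Lam_nonneg[OF t] by simp
    have "norm (f K t) = t ^ (2 * a) * \<bar>\<Sum>l<K. X l * (- z) ^ l\<bar> * ?E t"
      using t E0 unfolding feq z_def by (simp only: real_norm_def abs_mult abs_of_nonneg zero_le_power)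
    also have "\<dots> \<le> t ^ (2 * a) * (2 * ?S) * ?E t"
      using s t E0 by (intro mult_right_mono mult_left_mono) auto
    also have "t ^ (2 * a) * (2 * ?S) = 2 * (\<Sum>l<K. hchain (2 * a) 0 l * t ^ (2 * l + 2 * a))"
      unfolding z_def sum_distrib_left power_even_add by (simp only: mult_ac)
    also have "2 * (\<Sum>l<K. hchain (2 * a) 0 l * t ^ (2 * l + 2 * a)) * ?E t \<le> 2 * (Lam t ^ (2 * a) / fact (2 * a)) * ?E t"
      using hchain_partial_le[OF t, of "2 * a" K] E0 by (intro mult_right_mono) auto
    also have "\<dots> = b t" by (simp add: b_def power_add)
    finally show ?thesis .
  qed
  have "b integrable_on {0<..<1}"
    unfolding b_def
    using absolutely_integrable_Lam_power[of "2 * a + k"]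
    by (intro integrable_on_mult_right) (simp only: absolutely_integrable_on_def)
  then have "(\<lambda>K. integral {0<..<1} (f K)) \<longlonglongrightarrow> integral {0<..<1} g"
    using f bound conv by (intro dominated_convergence(2)[where h = b]) (auto simp: integrable_on_def)
  moreover have "integral {0<..<1} (f K) = (\<Sum>l<K. (-1) ^ l * X l * mom (2 * (l + a)) k)" for K
    using f by (rule integral_unique)
  moreover have "(g has_integral 1 / 2 * (\<Sum>l. (-1) ^ l * hchain (Suc (2 * a)) k l)) {0<..<1}"
    unfolding g_def by (intro has_integral_mult_right has_integral_hchain)
  then have "integral {0<..<1} g = (\<Sum>l. (-1) ^ l * hchain (Suc (2 * a)) k l) / 2"
    by (simp add: integral_unique)
  ultimately show ?thesis unfolding sums_def X_def by simp
qed

text \<open>\<open>Tone a (n + 1)\<close> vanishes for \<open>n < a\<close>, so the series starts at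
  \<open>n = a\<close>. That shift gives the sign \<open>(-1) ^ (a + 1)\<close>, and the odd length
  \<open>2 * a + 1\<close> in \<open>W\<close> gives one more minus.\<close>

lemma sums_Tone_mom:
  "(\<lambda>n. (-1) ^ (n + 1) * Tone a (n + 1) * mom (2 * n) k) sums ((-1) ^ a * W (k + (2 * a + 1)) (2 * a + 1) / 2)"
proof -
  let ?f = "\<lambda>n. (-1) ^ (n + 1) * Tone a (n + 1) * mom (2 * n) k"
  have z: "?f n = 0" if "n < a" for n using that Tone_eq_hchain[of a n] by simp
  have s: "?f (l + a) = (-1) ^ (a + 1) * ((-1) ^ l * (\<Sum>i\<le>l. hchain (2 * a) 0 i) * mom (2 * (l + a)) k)" for l
    using Tone_eq_hchain[of a "l + a"] by (simp add: Suc_diff_le lessThan_Suc_atMost power_add)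
  have "(\<lambda>l. ?f (l + a)) sums ((-1) ^ (a + 1) * ((\<Sum>l. (-1) ^ l * hchain (Suc (2 * a)) k l) / 2))"
    unfolding s by (intro sums_mult sums_partial_hchain_mom)
  then have "?f sums ((-1) ^ (a + 1) * ((\<Sum>l. (-1) ^ l * hchain (Suc (2 * a)) k l) / 2))"
    using sums_zero_iff_shift[of a ?f, OF z] by blast
  moreover have "W (k + (2 * a + 1)) (2 * a + 1) = - (\<Sum>l. (-1) ^ l * hchain (Suc (2 * a)) k l)"
    using W_eq_hchain[of "2 * a + 1" k] by simp
  ultimately show ?thesis by simp
qed

text \<open>The numbers \<open>Z j p\<close> express the second T sum, divided by
  \<open>2 n - 1\<close>, as a finite combination of even moments. The series is therefore a finite
  combination of the convergent series in \<open>sums_Tone_mom\<close>, which gives summability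
  together with the value.\<close>

theorem mainTheorem9:
  fixes m p :: nat
  assumes "1 \<le> m" and "1 \<le> p"
  shows "summable (\<lambda>n. Tone (m - 1) (n + 1) * Tone (p - 1) (n + 1) / (2 * real (n + 1) - 1) * (-1) ^ (n + 1))
    \<and> 2 * (\<Sum>n. Tone (m - 1) (n + 1) * Tone (p - 1) (n + 1) / (2 * real (n + 1) - 1) * (-1) ^ (n + 1))
      = (-1) ^ (m - 1) * (\<Sum>j = 1..p. W (2 * j + 2 * m - 3) (2 * m - 1) * Z j p)"
proof -
  obtain a where m: "m = Suc a" using assms(1) by (cases m) auto
  let ?f = "\<lambda>n. Tone (m - 1) (n + 1) * Tone (p - 1) (n + 1) / (2 * real (n + 1) - 1) * (-1) ^ (n + 1)"
  define S where "S = (\<Sum>j = 1..p. (-1) ^ a * W (2 * (j - 1) + (2 * a + 1)) (2 * a + 1) / 2 * Z j p)"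
  have mom: "mom (2 * n) (2 * (j - 1)) = (\<Sum>i = 1..j. 2 * zetabar (2 * (j - i)) * Tone (i - 1) (n + 1)) / (2 * real n + 1)"
    if "1 \<le> j" for n j
  proof -
    have "(\<Sum>i = 1..j. 2 * zetabar (2 * (j - i)) * Tone (i - 1) (n + 1))
        = (\<Sum>i\<le>j - 1. 2 * zetabar (2 * (j - 1 - i)) * Tone i (Suc n))"
      by (rule sum.reindex_bij_witness[of _ Suc "\<lambda>i. i - 1"]) (use that in auto)
    then show ?thesis using mom_eq_Tone(2)[of n "j - 1"] by (simp add: field_simps)
  qed
  have "(\<lambda>n. \<Sum>j = 1..p. (-1) ^ (n + 1) * Tone a (n + 1) * mom (2 * n) (2 * (j - 1)) * Z j p) sums S"
    unfolding S_def by (intro sums_sum sums_mult2 sums_Tone_mom)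
  moreover have "(\<Sum>j = 1..p. (-1) ^ (n + 1) * Tone a (n + 1) * mom (2 * n) (2 * (j - 1)) * Z j p) = ?f n" for n
  proof -
    have "(\<Sum>j = 1..p. (-1) ^ (n + 1) * Tone a (n + 1) * mom (2 * n) (2 * (j - 1)) * Z j p)
       = (-1) ^ (n + 1) * Tone a (n + 1) / (2 * real n + 1) *
          (\<Sum>j = 1..p. (\<Sum>i = 1..j. 2 * zetabar (2 * (j - i)) * Tone (i - 1) (n + 1)) * Z j p)"
      unfolding sum_distrib_left
    proof (intro sum.cong refl)
      fix j assume "j \<in> {1..p}"
      then have j: "1 \<le> j" by simp
      show "(-1) ^ (n + 1) * Tone a (n + 1) * mom (2 * n) (2 * (j - 1)) * Z j p =
          (-1) ^ (n + 1) * Tone a (n + 1) / (2 * real n + 1) *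
          ((\<Sum>i = 1..j. 2 * zetabar (2 * (j - i)) * Tone (i - 1) (n + 1)) * Z j p)"
        unfolding mom[OF j] by (simp only: times_divide_eq_left times_divide_eq_right mult.assoc)
    qed
    \<comment> \<open>The inversion collapses the double sum to its term with index
      \<open>p\<close>.\<close>
    also have "\<dots> = (-1) ^ (n + 1) * Tone a (n + 1) / (2 * real n + 1) * Tone (p - 1) (n + 1)"
      unfolding Z_inversion[OF assms(2), of "\<lambda>i. Tone (i - 1) (n + 1)"] ..
    finally have "(\<Sum>j = 1..p. (-1) ^ (n + 1) * Tone a (n + 1) * mom (2 * n) (2 * (j - 1)) * Z j p)
        = (-1) ^ (n + 1) * Tone a (n + 1) / (2 * real n + 1) * Tone (p - 1) (n + 1)" .
    moreover have "2 * real (n + 1) - 1 = 2 * real n + 1" by simp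
    ultimately show ?thesis by (simp only: m diff_Suc_1 times_divide_eq_left times_divide_eq_right mult_ac)
  qed
  ultimately have f: "?f sums S" by simp
  have "2 * S = (-1) ^ a * (\<Sum>j = 1..p. W (2 * j + 2 * m - 3) (2 * m - 1) * Z j p)"
    unfolding S_def sum_distrib_left
  proof (intro sum.cong refl)
    fix j assume "j \<in> {1..p}"
    \<comment> \<open>No natural subtraction truncates here, since \<open>j\<close> and
      \<open>m\<close> are at least 1.\<close>
    then have "2 * (j - 1) + (2 * a + 1) = 2 * j + 2 * m - 3" "2 * a + 1 = 2 * m - 1" using m by auto
    then have e: "W (2 * (j - 1) + (2 * a + 1)) (2 * a + 1) = W (2 * j + 2 * m - 3) (2 * m - 1)"
      by (simp only:)
    show "2 * ((-1) ^ a * W (2 * (j - 1) + (2 * a + 1)) (2 * a + 1) / 2 * Z j p)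
        = (-1) ^ a * (W (2 * j + 2 * m - 3) (2 * m - 1) * Z j p)" unfolding e by simp
  qed
  then show ?thesis using f by (simp add: sums_iff m)
qed

end
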